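(* For every $n\ge 2$, the tropical Pollaczek-Geiringer variety $\mathrm{trop}(\mathrm{CM}_n^2)$, viewed in tropical projective space $\mathbb{R}^{\binom{[n]}{2}}/\mathbb{R}(1,\dots,1)^T$, admits a simplicial fan structure isomorphic to the tree pair complex $\mathrm{TP}(n)$.
   Context: Coordinates of $\mathbb{R}^{\binom{[n]}{2}}$ are indexed by pairs $uv$, $u<v$ in $[n]$. The Cayley-Menger variety $\mathrm{CM}_n^d\subseteq\mathbb{C}^{\binom{[n]}{2}}$ is the Zariski closure of $\{(\|p_u-p_v\|^2)_{u<v}: p_1,\dots,p_n\in\mathbb{R}^d\}$; $\mathrm{CM}_n^2$ is the Pollaczek-Geiringer variety. Tropicalization (max convention): over the Puiseux series field $K=\mathbb{C}\{\!\{t\}\!\}$ with $\mathrm{val}(a)=-(\text{smallest exponent of }t\text{ in }a)$, $\mathrm{trop}(X)$ for $X\subseteq\mathbb{C}^S$ with ideal $I$ is the Euclidean closure of $\{(\mathrm{val}(x_i))_i: x\in V_K(I)\}\cap\mathbb{R}^S$. The set $\mathrm{trop}(\mathrm{CM}_n^2)$ is invariant under adding real multiples of $(1,\dots,1)^T$, so it may be considered in the quotient $\mathbb{R}^{\binom{[n]}{2}}/\mathbb{R}(1,\dots,1)^T$. A rooted tree on leaf set $[n]$ is a rooted tree whose leaves are labeled bijectively by $[n]$ and whose internal vertices each have at least two children. A clade of such a tree $T$ is the set of leaves below some internal vertex; $\mathrm{clade}(T)$ is the set of all clades of $T$ (it always contains $[n]$, the clade of the root). The tree pair complex $\mathrm{TP}(n)$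 is the abstract simplicial complex on ground set $2^{[n]}$ whose faces are all sets of the form $\mathrm{clade}(T_1)\cup\mathrm{clade}(T_2)$ for rooted trees $T_1,T_2$ on leaf set $[n]$. *)

theory Defs
  imports "HOL-Analysis.Analysis" "HOL-Computational_Algebra.Formal_Laurent_Series"
begin

text \<open>Coordinates of R^(binom [n] 2) are indexed by pairs (u,v) with 1 <= u < v <= n.
  Vectors are functions on nat \<times> nat that vanish outside these pairs.\<close>

definition pairs :: "nat \<Rightarrow> (nat \<times> nat) set" where
  "pairs n = {(u, v). 1 \<le> u \<and> u < v \<and> v \<le> n}"

text \<open>A polynomial is a finitely supported map from monomials (exponent vectors)
  to complex coefficients; its monomials only involve the variables indexed by pairs n.\<close>

type_synonym cpoly = "((nat \<times> nat) \<Rightarrow> nat) \<Rightarrow> complex"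

definition is_poly :: "nat \<Rightarrow> cpoly \<Rightarrow> bool" where
  "is_poly n f \<longleftrightarrow> finite {m. f m \<noteq> 0} \<and>
     (\<forall>m. f m \<noteq> 0 \<longrightarrow> (\<forall>i. i \<notin> pairs n \<longrightarrow> m i = 0))"

definition peval :: "(complex \<Rightarrow> 'a::comm_ring_1) \<Rightarrow> nat \<Rightarrow> cpoly \<Rightarrow> ((nat \<times> nat) \<Rightarrow> 'a) \<Rightarrow> 'a" where
  "peval phi n f x = (\<Sum>m\<in>{m. f m \<noteq> 0}. phi (f m) * (\<Prod>i\<in>pairs n. x i ^ m i))"

text \<open>The ideal of the Zariski closure CM_n^d of the set of squared-distance vectors
  of n points p_1..p_n in R^d (points given as p u k, k < d) is the ideal of all complex
  polynomials vanishing on that set.\<close>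

definition cm_ideal :: "nat \<Rightarrow> nat \<Rightarrow> cpoly set" where
  "cm_ideal n d = {f. is_poly n f \<and>
     (\<forall>p :: nat \<Rightarrow> nat \<Rightarrow> real.
        peval (\<lambda>c. c) n f
          (\<lambda>i. complex_of_real (\<Sum>k<d. (p (fst i) k - p (snd i) k)^2)) = 0)}"

text \<open>Points of V_K(I) over the Puiseux series field K = union over N >= 1 of C((t^(1/N))):
  any finite tuple of Puiseux series lies in C((s)) for s = t^(1/N) and some N, where it is a
  tuple of formal Laurent series in s. For a nonzero Laurent series a in s, the smallest
  exponent of t is (subdegree a)/N, so val(a) = - (subdegree a)/N.\<close>

definition trop_pts :: "nat \<Rightarrow> cpoly set \<Rightarrow> ((nat \<times> nat) \<Rightarrow> real) set" where
  "trop_pts n I = {w. (\<forall>i. i \<notin> pairs n \<longrightarrow> w i = 0) \<and>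
     (\<exists>N::nat. N > 0 \<and> (\<exists>x :: (nat \<times> nat) \<Rightarrow> complex fls.
        (\<forall>f\<in>I. peval fls_const n f x = 0) \<and>
        (\<forall>i\<in>pairs n. x i \<noteq> 0 \<and> w i = - of_int (fls_subdegree (x i)) / real N)))}"

definition trop :: "nat \<Rightarrow> cpoly set \<Rightarrow> ((nat \<times> nat) \<Rightarrow> real) set" where
  "trop n I = closure (trop_pts n I)"

datatype rtree = Leaf nat | Node "rtree list"

fun leaves :: "rtree \<Rightarrow> nat list" where
  "leaves (Leaf i) = [i]"
| "leaves (Node ts) = concat (map leaves ts)"

fun wf_rtree :: "rtree \<Rightarrow> bool" where
  "wf_rtree (Leaf i) = True"
| "wf_rtree (Node ts) = (2 \<le> length ts \<and> (\<forall>t\<in>set ts. wf_rtree t))"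

fun clades :: "rtree \<Rightarrow> nat set set" where
  "clades (Leaf i) = {}"
| "clades (Node ts) = insert (set (leaves (Node ts))) (\<Union>t\<in>set ts. clades t)"

definition rooted_tree_on :: "nat \<Rightarrow> rtree \<Rightarrow> bool" where
  "rooted_tree_on n T \<longleftrightarrow> wf_rtree T \<and> distinct (leaves T) \<and> set (leaves T) = {1..n}"

definition TP :: "nat \<Rightarrow> nat set set set" where
  "TP n = {clades T1 \<union> clades T2 | T1 T2. rooted_tree_on n T1 \<and> rooted_tree_on n T2}"

text \<open>Cones in the quotient are represented by their preimages in R^S, i.e. they contain
  the line R(1,...,1). The cone spanned by the rays rho A, A in F, modulo the lineality:\<close>

definition qcone :: "nat \<Rightarrow> (nat set \<Rightarrow> (nat \<times> nat) \<Rightarrow> real) \<Rightarrow> nat set set \<Rightarrow> ((nat \<times> nat) \<Rightarrow> real) set" where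
  "qcone n rho F = {w. \<exists>(lam :: nat set \<Rightarrow> real) (mu :: real). (\<forall>A\<in>F. lam A \<ge> 0) \<and>
      (\<forall>i. w i = (if i \<in> pairs n then (\<Sum>A\<in>F. lam A * rho A i) + mu else 0))}"

definition indep_mod_ones :: "nat \<Rightarrow> (nat set \<Rightarrow> (nat \<times> nat) \<Rightarrow> real) \<Rightarrow> nat set set \<Rightarrow> bool" where
  "indep_mod_ones n rho F \<longleftrightarrow> (\<forall>(lam :: nat set \<Rightarrow> real) (mu :: real).
      (\<forall>i\<in>pairs n. (\<Sum>A\<in>F. lam A * rho A i) + mu = 0) \<longrightarrow> (\<forall>A\<in>F. lam A = 0))"

text \<open>A simplicial fan structure on X (a subset of the quotient, represented by its preimage)
  isomorphic to TP(n): every face F of TP(n) contains the root clade [n], which is the cone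
  point of TP(n); it is sent to the lineality space R(1,...,1) (the origin of the quotient),
  and every other vertex A (a clade) is sent to a ray rho A. The face F corresponds to the
  simplicial cone spanned by the rays of F - {[n]}; these cones are simplicial, cover X, and
  intersect pairwise in the cone of the common face, so F \<mapsto> cone(F) is an isomorphism of
  TP(n) onto the face poset of a simplicial fan with support X.\<close>

definition simplicial_fan_iso_TP :: "nat \<Rightarrow> ((nat \<times> nat) \<Rightarrow> real) set \<Rightarrow> bool" where
  "simplicial_fan_iso_TP n X \<longleftrightarrow>
     (\<exists>rho :: nat set \<Rightarrow> (nat \<times> nat) \<Rightarrow> real.
        (\<forall>F\<in>TP n. indep_mod_ones n rho (F - {{1..n}})) \<and>
        (\<Union>F\<in>TP n. qcone n rho (F - {{1..n}})) = X \<and>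
        (\<forall>F\<in>TP n. \<forall>G\<in>TP n.
            qcone n rho (F - {{1..n}}) \<inter> qcone n rho (G - {{1..n}}) = qcone n rho ((F \<inter> G) - {{1..n}})))"

end

theory Submission
  imports Defs
begin

text \<open>Over the complex numbers the planar squared distance factors as
  \<open>(X\<^sub>u - X\<^sub>v)(Y\<^sub>u - Y\<^sub>v)\<close> in isotropic coordinates, so the tropical variety consists of the sums of
  two ultrametrics. For the inclusion of the tropical variety in these sums, the \<open>3 \<times> 3\<close> minors of the Gram
  matrix lie in the ideal, so a point of the variety over the Puiseux series comes from a quadratic
  form of rank at most two, which splits into two linear factors after adjoining a square root. An
  ultrametric is a nonnegative combination of the rays \<open>- 1\<^sub>A\<close> (\<open>1\<^sub>A\<close> the indicator of the pairs inside
  \<open>A\<close>), with \<open>A\<close> ranging over the clades of a tree, modulo constants.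

  That the cones form a simplicial fan rests on one observation: if all pairs inside \<open>A\<close> are covered by
  the members of two laminar families, then a single member contains \<open>A\<close>. Given two nonnegative
  combinations with the same value, apply this to a largest set \<open>A\<close> at which the coefficients differ:
  all pairs inside \<open>A\<close> must be covered by sets with the opposite sign of the difference, and one of these
  contains \<open>A\<close>, hence equals \<open>A\<close>, a contradiction.\<close>

section \<open>Laminar families and trees\<close>

definition laminar :: "'a set set \<Rightarrow> bool" where
  "laminar L \<longleftrightarrow> (\<forall>A\<in>L. \<forall>B\<in>L. A \<subseteq> B \<or> B \<subseteq> A \<or> A \<inter> B = {})"

lemma laminar_subset: "laminar L \<Longrightarrow> M \<subseteq> L \<Longrightarrow> laminar M"
  unfolding laminar_def by blast

text \<open>Members containing \<open>u\<close> pairwise meet, so they form a chain; the largest one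
  contains every point that shares a member with \<open>u\<close>.\<close>

lemma laminar_star_contained:
  assumes "finite L" "laminar L" "u \<in> A" "A \<noteq> {u}"
    and star: "\<And>w. w \<in> A \<Longrightarrow> w \<noteq> u \<Longrightarrow> \<exists>B\<in>L. u \<in> B \<and> w \<in> B"
  shows "\<exists>B\<in>L. A \<subseteq> B"
proof -
  let ?U = "{B \<in> L. u \<in> B}"
  obtain w where "w \<in> A" "w \<noteq> u"
    using assms(3,4) by blast
  then have "?U \<noteq> {}"
    using star by blast
  moreover have "finite ?U"
    using assms(1) by simp
  ultimately obtain B where B: "B \<in> ?U" "\<And>C. C \<in> ?U \<Longrightarrow> B \<subseteq> C \<Longrightarrow> B = C"
    using finite_has_maximal[of ?U] by blast
  have "v \<in> B" if v: "v \<in> A" for v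
  proof (cases "v = u")
    case False
    then obtain C where C: "C \<in> L" "u \<in> C" "v \<in> C"
      using star v by blast
    then have "C \<subseteq> B \<or> B \<subseteq> C"
      using B(1) assms(2) unfolding laminar_def by blast
    then show ?thesis
      using B(2)[of C] C by blast
  qed (use B in simp)
  then show ?thesis
    using B(1) by blast
qed

text \<open>A complete graph is not the union of two proper equivalence relations.\<close>

lemma clique_cover_by_two_laminar:
  assumes fin: "finite L" "finite M" and lam: "laminar L" "laminar M"
    and two: "\<exists>u\<in>A. \<exists>v\<in>A. u \<noteq> v"
    and cover: "\<And>u v. u \<in> A \<Longrightarrow> v \<in> A \<Longrightarrow> u \<noteq> v \<Longrightarrow> \<exists>B\<in>L \<union> M. u \<in> B \<and> v \<in> B"
  shows "\<exists>B\<in>L \<union> M. A \<subseteq> B"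
proof (cases "\<forall>u\<in>A. \<forall>v\<in>A. u \<noteq> v \<longrightarrow> (\<exists>B\<in>L. u \<in> B \<and> v \<in> B)")
  case True
  obtain u where u: "u \<in> A" "A \<noteq> {u}"
    using two by blast
  have "\<exists>B\<in>L. A \<subseteq> B"
    by (rule laminar_star_contained[OF fin(1) lam(1) u]) (use True u in blast)
  then show ?thesis by blast
next
  case False
  then obtain u v where uv: "u \<in> A" "v \<in> A" "u \<noteq> v"
    and nL: "\<And>B. B \<in> L \<Longrightarrow> u \<in> B \<Longrightarrow> v \<in> B \<Longrightarrow> False"
    by blast
  obtain C where C: "C \<in> M" "u \<in> C" "v \<in> C"
    using cover[OF uv] nL by blast
  \<comment> \<open>An edge \<open>uw\<close> missed by \<open>M\<close> lies in some
    \<open>D\<close> of \<open>L\<close>. The third edge \<open>wv\<close> then has no place: a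
    member of \<open>L\<close> on it would be nested with \<open>D\<close>, and the larger one would
    join \<open>u\<close> to \<open>v\<close>; a member of \<open>M\<close> would be nested with
    \<open>C\<close>, and the larger one would join \<open>u\<close> to \<open>w\<close>.\<close>
  have "\<exists>B\<in>M. u \<in> B \<and> w \<in> B" if w: "w \<in> A" "w \<noteq> u" for w
  proof (rule ccontr)
    assume nM: "\<not> ?thesis"
    then obtain D where D: "D \<in> L" "u \<in> D" "w \<in> D"
      using cover[OF uv(1) w(1)] w(2) by blast
    have "w \<noteq> v"
      using nM C by blast
    then obtain E where E: "E \<in> L \<union> M" "w \<in> E" "v \<in> E"
      using cover[OF w(1) uv(2)] by blast
    show False
    proof (cases "E \<in> L")
      case True
      then have "D \<subseteq> E \<or> E \<subseteq> D"
        using D E lam(1) unfolding laminar_def by blast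
      then show False
        using nL[of D] nL[of E] D E True by blast
    next
      case False
      then have "E \<in> M" using E by blast
      then have "C \<subseteq> E \<or> E \<subseteq> C"
        using C E lam(2) unfolding laminar_def by blast
      then show False
        using nM C E \<open>E \<in> M\<close> by blast
    qed
  qed
  moreover have "A \<noteq> {u}"
    using uv by blast
  ultimately have "\<exists>B\<in>M. A \<subseteq> B"
    by (intro laminar_star_contained[OF fin(2) lam(2) uv(1)])
  then show ?thesis by blast
qed

section \<open>Uniqueness of the weights on two laminar families\<close>

definition clique_sum :: "'a set set \<Rightarrow> ('a set \<Rightarrow> 'b::semiring_1) \<Rightarrow> 'a \<Rightarrow> 'a \<Rightarrow> 'b" where
  "clique_sum W l u v = (\<Sum>A\<in>W. l A * of_bool (u \<in> A \<and> v \<in> A))"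

lemma clique_sum_unique:
  fixes l l' :: "'a set \<Rightarrow> real"
  assumes W: "finite W" "\<And>A. A \<in> W \<Longrightarrow> 2 \<le> card A"
    and nonneg: "\<And>A. A \<in> W \<Longrightarrow> 0 \<le> l A" "\<And>A. A \<in> W \<Longrightarrow> 0 \<le> l' A"
    and L: "\<And>A. A \<in> W \<Longrightarrow> l A \<noteq> 0 \<Longrightarrow> A \<in> L1 \<union> L2" "laminar L1" "laminar L2"
    and M: "\<And>A. A \<in> W \<Longrightarrow> l' A \<noteq> 0 \<Longrightarrow> A \<in> M1 \<union> M2" "laminar M1" "laminar M2"
    and eq: "\<And>u v. u \<noteq> v \<Longrightarrow> clique_sum W l u v = clique_sum W l' u v"
    and A: "A \<in> W"
  shows "l A = l' A"
proof -
  \<comment> \<open>Kept general in \<open>l\<close> and \<open>l'\<close> because it is applied to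
    both signs of the difference, with the two functions exchanged.\<close>
  have step: False
    if gt: "l A > l' A" and A: "A \<in> W"
      and maxA: "\<And>B. B \<in> W \<Longrightarrow> l B \<noteq> l' B \<Longrightarrow> card B \<le> card A"
      and nonneg: "\<And>A. A \<in> W \<Longrightarrow> 0 \<le> l A"
      and M: "\<And>A. A \<in> W \<Longrightarrow> l' A \<noteq> 0 \<Longrightarrow> A \<in> M1 \<union> M2" "laminar M1" "laminar M2"
      and eq: "\<And>u v. u \<noteq> v \<Longrightarrow> clique_sum W l u v = clique_sum W l' u v"
    for l l' :: "'a set \<Rightarrow> real" and A M1 M2
  proof -
    let ?less = "{B \<in> W. l B < l' B}"
    \<comment> \<open>If no set with \<open>l B < l' B\<close> contained \<open>u\<close> and
      \<open>v\<close>, comparing the two sums term by term, strictly at \<open>A\<close>, would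
      contradict \<open>eq\<close>.\<close>
    have edge: "\<exists>B\<in>?less. u \<in> B \<and> v \<in> B" if uv: "u \<in> A" "v \<in> A" "u \<noteq> v" for u v
    proof (rule ccontr)
      assume "\<not> ?thesis"
      then have le: "l' B * of_bool (u \<in> B \<and> v \<in> B) \<le> l B * of_bool (u \<in> B \<and> v \<in> B)" if "B \<in> W" for B
        using that by (auto simp: of_bool_def not_less)
      have "clique_sum W l' u v < clique_sum W l u v"
        unfolding clique_sum_def by (rule sum_strict_mono_ex1) (use W le gt A uv in auto)
      then show False using eq[OF uv(3)] by simp
    qed
    \<comment> \<open>\<open>l B < l' B\<close> together with \<open>0 \<le> l B\<close> makes
      \<open>l' B\<close> nonzero, so only members of \<open>M1\<close> and \<open>M2\<close>
      occur.\<close>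
    have sub: "?less \<subseteq> M1 \<union> M2"
      using nonneg M(1) by force
    have "\<not> card A \<le> Suc 0"
      using W(2)[OF A] by simp
    moreover have "finite A"
      using W(2)[OF A] card.infinite by fastforce
    ultimately have "\<exists>u\<in>A. \<exists>v\<in>A. u \<noteq> v"
      using card_le_Suc0_iff_eq by blast
    then have "\<exists>B\<in>(M1 \<inter> ?less) \<union> (M2 \<inter> ?less). A \<subseteq> B"
    proof (rule clique_cover_by_two_laminar[rotated 4])
      show "\<exists>B\<in>(M1 \<inter> ?less) \<union> (M2 \<inter> ?less). u \<in> B \<and> v \<in> B" if "u \<in> A" "v \<in> A" "u \<noteq> v" for u v
        using edge[OF that] sub by blast
    qed (use W(1) M(2,3) in \<open>auto intro: laminar_subset\<close>)
    then obtain B where B: "B \<in> ?less" "A \<subseteq> B" by blast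
    have "finite B"
      using W(2)[of B] B card.infinite by fastforce
    moreover have "card B \<le> card A"
      using maxA[of B] B by auto
    ultimately have "A = B"
      using B(2) card_seteq by blast
    then show False using B(1) gt by auto
  qed
  show ?thesis
  proof (rule ccontr)
    assume neq: "l A \<noteq> l' A"
    let ?D = "{A \<in> W. l A \<noteq> l' A}"
    have "Max (card ` ?D) \<in> card ` ?D"
      using neq A W by (intro Max_in) auto
    then obtain B where B: "B \<in> ?D" "card B = Max (card ` ?D)" by auto
    have maxB: "card C \<le> card B" if "C \<in> W" "l C \<noteq> l' C" for C
      unfolding B(2) using that W by (intro Max_ge) auto
    show False
    proof (cases "l B > l' B")
      case True
      show False
        by (rule step[OF True _ maxB nonneg(1) M eq]) (use B in auto)
    next
      case False
      then have "l' B > l B" using B by auto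
      then show False
        by (rule step[OF _ _ _ nonneg(2) L eq[symmetric]]) (use B maxB in force)+
    qed
  qed
qed

section \<open>Trees as laminar families\<close>

lemma distinct_concat_map_disjoint:
  assumes "distinct (concat (map f xs))" "x \<in> set xs" "y \<in> set xs" "x \<noteq> y"
  shows "set (f x) \<inter> set (f y) = {}"
  using assms by (induction xs) auto

lemma distinct_concat_mapI:
  assumes "distinct xs" "\<And>x. x \<in> set xs \<Longrightarrow> distinct (f x)"
    and "\<And>x y. x \<in> set xs \<Longrightarrow> y \<in> set xs \<Longrightarrow> x \<noteq> y \<Longrightarrow> set (f x) \<inter> set (f y) = {}"
  shows "distinct (concat (map f xs))"
  using assms by (induction xs) fastforce+

text \<open>Nonempty leaf sets are part of the induction: two children with disjoint nonempty leaf
  sets give the root clade its two elements. Clades from different children are disjoint because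
  labels are distinct.\<close>

lemma clades_props:
  assumes "wf_rtree T" "distinct (leaves T)"
  shows "set (leaves T) \<noteq> {} \<and> laminar (clades T) \<and> (\<forall>A\<in>clades T. A \<subseteq> set (leaves T) \<and> 2 \<le> card A)"
  using assms
proof (induction T)
  case (Leaf x)
  then show ?case by (simp add: laminar_def)
next
  case (Node ts)
  have dist: "distinct (leaves t)" if "t \<in> set ts" for t
    using Node.prems that by (auto simp: distinct_concat_iff)
  have IH: "set (leaves t) \<noteq> {}" "laminar (clades t)"
    "\<And>A. A \<in> clades t \<Longrightarrow> A \<subseteq> set (leaves t)" "\<And>A. A \<in> clades t \<Longrightarrow> 2 \<le> card A" if "t \<in> set ts" for t
    using Node.IH[OF that] Node.prems dist[OF that] that by auto
  let ?S = "set (leaves (Node ts))"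
  obtain t0 t1 r where ts: "ts = t0 # t1 # r"
    using Node.prems by (cases ts; cases "tl ts") auto
  obtain a b where ab: "a \<in> set (leaves t0)" "b \<in> set (leaves t1)"
    using IH(1)[of t0] IH(1)[of t1] ts by fastforce
  have "a \<noteq> b"
    using Node.prems ab ts by auto
  moreover have "{a, b} \<subseteq> ?S"
    using ab ts by auto
  ultimately have card: "2 \<le> card ?S"
    using card_mono[of ?S "{a, b}"] by auto
  have disj: "set (leaves t) \<inter> set (leaves t') = {}"
    if "t \<in> set ts" "t' \<in> set ts" "t \<noteq> t'" for t t'
    using distinct_concat_map_disjoint[of leaves ts] Node.prems that by auto
  have sub: "A \<subseteq> ?S" "2 \<le> card A" if "A \<in> clades (Node ts)" for A
    using that card IH(3,4) by fastforce+
  have "A \<subseteq> B \<or> B \<subseteq> A \<or> A \<inter> B = {}" if AB: "A \<in> clades (Node ts)" "B \<in> clades (Node ts)" for A B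
  proof (cases "A = ?S \<or> B = ?S")
    case True
    then show ?thesis using sub AB by blast
  next
    case False
    then obtain t t' where t: "t \<in> set ts" "A \<in> clades t" "t' \<in> set ts" "B \<in> clades t'"
      using AB by auto
    show ?thesis
    proof (cases "t = t'")
      case True
      then show ?thesis using IH(2)[OF t(1)] t by (auto simp: laminar_def)
    next
      case False
      then show ?thesis using disj[OF t(1,3)] IH(3)[OF t(1,2)] IH(3)[OF t(3,4)] by blast
    qed
  qed
  then have "laminar (clades (Node ts))"
    unfolding laminar_def by blast
  then show ?case
    using sub card by (auto simp del: leaves.simps clades.simps)
qed

text \<open>The tree is built from the top: the root clade is \<open>S\<close>, and each block below
  it carries the members of \<open>L\<close> inside that block. A single point is a leaf without
  clades, hence the condition \<open>2 \<le> card S\<close> in the last premise.\<close>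

lemma exists_rtree_of_laminar:
  assumes "finite S" "S \<noteq> {}" "laminar L" "\<And>A. A \<in> L \<Longrightarrow> A \<subseteq> S \<and> 2 \<le> card A"
    and "2 \<le> card S \<Longrightarrow> S \<in> L"
  shows "\<exists>T. wf_rtree T \<and> distinct (leaves T) \<and> set (leaves T) = S \<and> clades T = L"
  using assms
proof (induction "card S" arbitrary: S L rule: less_induct)
  case less
  show ?case
  proof (cases "2 \<le> card S")
    case False
    then have "card S = 1"
      using less.prems by (metis One_nat_def card_0_eq less_2_cases not_less)
    then obtain x where x: "S = {x}" by (auto simp: card_1_singleton_iff)
    have "L = {}"
    proof (rule ccontr)
      assume "L \<noteq> {}"
      then obtain A where A: "A \<in> L" by blast
      then show False
        using less.prems(4)[OF A] card_mono[OF less.prems(1), of A] False by auto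
    qed
    then show ?thesis
      using x by (intro exI[of _ "Leaf x"]) auto
  next
    case True
    then have SL: "S \<in> L" using less.prems by blast
    let ?L = "L - {S}"
    have finL: "finite L"
      using less.prems(1,4) by (intro finite_subset[of L "Pow S"]) auto
    \<comment> \<open>The leaf sets of the children of the root: the maximal proper members of
      \<open>L\<close>, and a singleton for each point in no proper member.\<close>
    define P where "P = {A \<in> ?L. \<forall>B\<in>?L. A \<subseteq> B \<longrightarrow> A = B} \<union> {{x} | x. x \<in> S - \<Union>?L}"
    have finP: "finite P"
      unfolding P_def using finL less.prems(1) by auto
    have P_sub: "B \<subset> S" "B \<noteq> {}" if "B \<in> P" for B
      using that less.prems(4) True unfolding P_def by fastforce+
    have P_disj: "B \<inter> C = {}" if "B \<in> P" "C \<in> P" "B \<noteq> C" for B C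
    proof -
      have max: "X \<in> L" "\<And>Y. Y \<in> ?L \<Longrightarrow> X \<subseteq> Y \<Longrightarrow> X = Y" if "X \<in> P" "X \<in> ?L" for X
        using that unfolding P_def by blast+
      have sing: "\<exists>x. X = {x} \<and> x \<notin> \<Union>?L" if "X \<in> P" "X \<notin> ?L" for X
        using that unfolding P_def by blast
      show ?thesis
      proof (cases "B \<in> ?L \<and> C \<in> ?L")
        case True
        then show ?thesis
          using max that less.prems(3) unfolding laminar_def by metis
      next
        case False
        then show ?thesis
          using sing[OF that(1)] sing[OF that(2)] that(3) by blast
      qed
    qed
    have below: "\<exists>B\<in>P. A \<subseteq> B" if "A \<in> ?L" for A
    proof -
      have "finite ?L" using finL by simp
      from finite_has_maximal2[OF this that] obtain B where "B \<in> ?L" "A \<subseteq> B" "\<forall>C\<in>?L. B \<subseteq> C \<longrightarrow> B = C"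
        by blast
      then show ?thesis unfolding P_def by blast
    qed
    have P_un: "\<Union>P = S"
    proof
      show "\<Union>P \<subseteq> S" using P_sub by blast
      show "S \<subseteq> \<Union>P"
      proof
        fix x assume "x \<in> S"
        show "x \<in> \<Union>P"
        proof (cases "x \<in> \<Union>?L")
          case True
          then show ?thesis using below by blast
        next
          case False
          then have "{x} \<in> P" unfolding P_def using \<open>x \<in> S\<close> by blast
          then show ?thesis by blast
        qed
      qed
    qed
    have "\<exists>T. wf_rtree T \<and> distinct (leaves T) \<and> set (leaves T) = B \<and> clades T = {A \<in> L. A \<subseteq> B}"
      if B: "B \<in> P" for B
    proof (rule less.hyps)
      show "card B < card S"
        using P_sub[OF B] less.prems(1) by (simp add: psubset_card_mono)
      show "finite B" "B \<noteq> {}"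
        using P_sub[OF B] less.prems(1) finite_subset by blast+
      show "laminar {A \<in> L. A \<subseteq> B}"
        using less.prems(3) by (rule laminar_subset) blast
      show "B \<in> {A \<in> L. A \<subseteq> B}" if "2 \<le> card B"
        using B that unfolding P_def by auto
    qed (use less.prems in auto)
    then obtain t where t: "\<And>B. B \<in> P \<Longrightarrow> wf_rtree (t B) \<and> distinct (leaves (t B)) \<and> set (leaves (t B)) = B
        \<and> clades (t B) = {A \<in> L. A \<subseteq> B}"
      by metis
    obtain ps where ps: "set ps = P" "distinct ps"
      using finite_distinct_list[OF finP] by blast
    let ?T = "Node (map t ps)"
    \<comment> \<open>The blocks are proper subsets of the nonempty set \<open>S\<close> with union
      \<open>S\<close>, so there are at least two.\<close>
    have "2 \<le> length ps"
    proof (rule ccontr)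
      assume "\<not> 2 \<le> length ps"
      then have "ps = [] \<or> (\<exists>B. ps = [B])"
        by (cases ps; cases "tl ps") auto
      then have "P = {} \<or> (\<exists>B. P = {B})" using ps(1) by force
      then show False
        using P_un P_sub(1) less.prems(2) by fastforce
    qed
    moreover have leaves: "set (leaves ?T) = S"
      using t ps(1) P_un by auto
    moreover have "distinct (leaves ?T)"
      using distinct_concat_mapI[of ps "leaves \<circ> t"] ps t P_disj by simp
    moreover have "clades ?T = L"
    proof -
      have "clades ?T = insert S (\<Union>B\<in>P. {A \<in> L. A \<subseteq> B})"
        using leaves t ps(1) by (simp del: leaves.simps)
      also have "\<dots> = L"
        using SL below by blast
      finally show ?thesis .
    qed
    ultimately show ?thesis
      using t ps(1) by (intro exI[of _ ?T]) auto
  qed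
qed

section \<open>The ideal of the Cayley--Menger variety\<close>

lemma finite_pairs: "finite (pairs n)"
  by (rule finite_subset[of _ "{1..n} \<times> {1..n}"]) (auto simp: pairs_def)

lemma peval_cong:
  assumes "\<And>i. i \<in> pairs n \<Longrightarrow> x i = y i"
  shows "peval phi n f x = peval phi n f y"
  unfolding peval_def using assms by (intro sum.cong refl arg_cong2[where f = "(*)"] prod.cong) auto

lemma peval_hom:
  assumes "h 0 = 0" "h 1 = 1" "\<And>a b. h (a + b) = h a + h b" "\<And>a b. h (a * b) = h a * h b"
  shows "h (peval phi n f x) = peval (\<lambda>c. h (phi c)) n f (\<lambda>i. h (x i))"
proof -
  have sum: "h (sum g S) = (\<Sum>s\<in>S. h (g s))" for g and S :: "((nat \<times> nat) \<Rightarrow> nat) set"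
    by (induction S rule: infinite_finite_induct) (simp_all add: assms)
  have prod: "h (prod g S) = (\<Prod>s\<in>S. h (g s))" for g and S :: "(nat \<times> nat) set"
    by (induction S rule: infinite_finite_induct) (simp_all add: assms)
  have pow: "h (a ^ k) = h a ^ k" for a k
    by (induction k) (simp_all add: assms)
  show ?thesis
    by (simp add: peval_def sum prod pow assms)
qed

text \<open>Zariski density of the real points. \<open>J\<close> holds the coordinates that may be
  arbitrary series; freeing one more turns the evaluation into a univariate polynomial over the
  field of Laurent series that has all real constants as roots.\<close>

lemma cm_ideal_vanishes_aux:
  fixes a :: "nat \<Rightarrow> nat \<Rightarrow> complex fls"
  assumes f: "f \<in> cm_ideal n d" and "finite J"
    and "\<And>u k. (u, k) \<notin> J \<Longrightarrow> \<exists>r. a u k = fls_const (complex_of_real r)"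
  shows "peval fls_const n f (\<lambda>i. \<Sum>k<d. (a (fst i) k - a (snd i) k)^2) = 0"
  using assms(2,3)
proof (induction J arbitrary: a rule: finite_induct)
  case empty
  then obtain r where r: "\<And>u k. a u k = fls_const (complex_of_real (r u k))"
    by (metis empty_iff)
  have sum: "fls_const (sum g S) = (\<Sum>k\<in>S. fls_const (g k))" for g :: "nat \<Rightarrow> complex" and S
    by (induction S rule: infinite_finite_induct) (simp_all add: fls_plus_const[symmetric])
  have "peval fls_const n f (\<lambda>i. \<Sum>k<d. (a (fst i) k - a (snd i) k)^2)
      = peval fls_const n f (\<lambda>i. fls_const (complex_of_real (\<Sum>k<d. (r (fst i) k - r (snd i) k)^2)))"
    by (intro peval_cong) (simp add: r sum fls_const_power fls_minus_const[symmetric])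
  also have "\<dots> = fls_const (peval (\<lambda>c. c) n f (\<lambda>i. complex_of_real (\<Sum>k<d. (r (fst i) k - r (snd i) k)^2)))"
    by (rule peval_hom[symmetric]) (simp_all add: fls_plus_const[symmetric])
  also have "\<dots> = 0"
    using f by (simp add: cm_ideal_def)
  finally show ?case .
next
  case (insert j J)
  obtain u0 k0 where j: "j = (u0, k0)" by (cases j)
  \<comment> \<open>The coordinate \<open>j\<close> becomes the indeterminate; all others stay
    constant.\<close>
  define P where "P u k = (if (u, k) = j then [:0, 1:] else [:a u k:])" for u k
  define p where "p = peval (\<lambda>c. [:fls_const c:]) n f (\<lambda>i. \<Sum>k<d. (P (fst i) k - P (snd i) k)^2)"
  have p: "poly p z = peval fls_const n f (\<lambda>i. \<Sum>k<d. (b (fst i) k - b (snd i) k)^2)"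
    if b: "\<And>u k. b u k = (if (u, k) = j then z else a u k)" for z b
  proof -
    have "poly p z = peval (\<lambda>c. poly [:fls_const c:] z) n f
        (\<lambda>i. poly (\<Sum>k<d. (P (fst i) k - P (snd i) k)^2) z)"
      unfolding p_def by (rule peval_hom) simp_all
    also have "\<dots> = peval fls_const n f (\<lambda>i. \<Sum>k<d. (b (fst i) k - b (snd i) k)^2)"
    proof -
      have "poly (P u k) z = b u k" for u k
        by (simp add: P_def b)
      then show ?thesis by (simp add: poly_sum)
    qed
    finally show ?thesis .
  qed
  have "poly p (fls_const (complex_of_real r)) = 0" for r
  proof -
    define b where "b u k = (if (u, k) = j then fls_const (complex_of_real r) else a u k)" for u k
    have "poly p (fls_const (complex_of_real r))
        = peval fls_const n f (\<lambda>i. \<Sum>k<d. (b (fst i) k - b (snd i) k)^2)"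
      by (rule p) (simp add: b_def)
    also have "\<dots> = 0"
      by (rule insert.IH) (use insert.prems in \<open>auto simp: b_def\<close>)
    finally show ?thesis .
  qed
  then have "range (\<lambda>r. fls_const (complex_of_real r)) \<subseteq> {z. poly p z = 0}"
    by auto
  moreover have "infinite (range (\<lambda>r. fls_const (complex_of_real r)))"
  proof -
    have "inj (\<lambda>r. fls_const (complex_of_real r))"
      by (rule injI) (metis fls_const_nth of_real_eq_iff)
    then show ?thesis
      using finite_imageD infinite_UNIV_char_0 by blast
  qed
  ultimately have "p = 0"
    using poly_roots_finite finite_subset by blast
  have "peval fls_const n f (\<lambda>i. \<Sum>k<d. (a (fst i) k - a (snd i) k)^2) = poly p (a u0 k0)"
    by (rule p[symmetric]) (simp add: j)
  with \<open>p = 0\<close> show ?case by simp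
qed

lemma cm_ideal_vanishes:
  fixes a :: "nat \<Rightarrow> nat \<Rightarrow> complex fls"
  assumes "f \<in> cm_ideal n d"
  shows "peval fls_const n f (\<lambda>i. \<Sum>k<d. (a (fst i) k - a (snd i) k)^2) = 0"
proof -
  \<comment> \<open>Coordinates that \<open>f\<close> cannot see are set to the constant 0, which
    leaves only finitely many arbitrary ones.\<close>
  define b where "b u k = (if u \<le> n \<and> k < d then a u k else 0)" for u k
  have "peval fls_const n f (\<lambda>i. \<Sum>k<d. (a (fst i) k - a (snd i) k)^2)
      = peval fls_const n f (\<lambda>i. \<Sum>k<d. (b (fst i) k - b (snd i) k)^2)"
    by (rule peval_cong) (auto simp: b_def pairs_def)
  also have "\<dots> = 0"
  proof (rule cm_ideal_vanishes_aux[OF assms])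
    show "finite ({..n} \<times> {..<d})" by simp
    show "\<exists>r. b u k = fls_const (complex_of_real r)" if "(u, k) \<notin> {..n} \<times> {..<d}" for u k
      using that by (intro exI[of _ 0]) (auto simp: b_def)
  qed
  finally show ?thesis .
qed

text \<open>In isotropic coordinates the planar squared distance factors as a product of differences.\<close>

lemma cm_ideal_vanishes_product:
  fixes X Y :: "nat \<Rightarrow> complex fls"
  assumes "f \<in> cm_ideal n 2"
  shows "peval fls_const n f (\<lambda>i. (X (fst i) - X (snd i)) * (Y (fst i) - Y (snd i))) = 0"
proof -
  \<comment> \<open>Inverts the isotropic change of coordinates: the squares of the two coordinates
    of \<open>a u\<close> add up to \<open>X u * Y u\<close>, since (X + Y)^2 - (X - Y)^2 = 4 X
    Y.\<close>
  define a where "a u k = (if k = 0 then fls_const (1/2) * (X u + Y u) else fls_const (\<i>/2) * (X u - Y u))"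
    for u and k :: nat
  have half: "fls_const (\<i>/2) * fls_const (\<i>/2) = - (fls_const (1/2) * fls_const (1/2) :: complex fls)"
    "4 * (fls_const (1/2) * fls_const (1/2)) = (1 :: complex fls)"
    by (simp_all only: fls_const_mult_const fls_const_uminus[symmetric]
        fls_const_numeral[symmetric] fls_const_1[symmetric]) simp_all
  have "(\<Sum>k<2. (a u k - a v k)^2) = (X u - X v) * (Y u - Y v)" for u v
  proof -
    have "(\<Sum>k<2. (a u k - a v k)^2)
        = (fls_const (1/2) * fls_const (1/2)) * (X u + Y u - X v - Y v)^2
        + (fls_const (\<i>/2) * fls_const (\<i>/2)) * (X u - Y u - X v + Y v)^2"
      unfolding a_def numeral_2_eq_2 by (simp add: power2_eq_square algebra_simps)
    also have "\<dots> = (4 * (fls_const (1/2) * fls_const (1/2))) * ((X u - X v) * (Y u - Y v))"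
      unfolding half(1) by (simp add: power2_eq_square algebra_simps)
    finally show ?thesis unfolding half(2) by simp
  qed
  then show ?thesis
    using cm_ideal_vanishes[OF assms, of a] by simp
qed

section \<open>Polynomial expressions and the Gram minors\<close>

lemma peval_superset:
  assumes "phi 0 = 0" "finite M" "{m. f m \<noteq> 0} \<subseteq> M"
  shows "peval phi n f x = (\<Sum>m\<in>M. phi (f m) * (\<Prod>i\<in>pairs n. x i ^ m i))"
  unfolding peval_def using assms by (intro sum.mono_neutral_left) auto

lemma peval_add:
  assumes "phi 0 = 0" "\<And>a b. phi (a + b) = phi a + phi b" "is_poly n f" "is_poly n g"
  shows "peval phi n (\<lambda>m. f m + g m) x = peval phi n f x + peval phi n g x"
proof -
  let ?M = "{m. f m \<noteq> 0} \<union> {m. g m \<noteq> 0}"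
  have fin: "finite ?M"
    using assms(3,4) by (simp add: is_poly_def)
  have "{m. f m + g m \<noteq> 0} \<subseteq> ?M" "{m. f m \<noteq> 0} \<subseteq> ?M" "{m. g m \<noteq> 0} \<subseteq> ?M" by auto
  note eqs = this[THEN peval_superset[where phi = phi and M = ?M and n = n and x = x, rotated 2], OF assms(1) fin]
  show ?thesis
    unfolding eqs assms(2) by (simp add: sum.distrib distrib_right)
qed

lemma peval_scale:
  assumes "phi 0 = 0" "\<And>a b. phi (a * b) = phi a * phi b" "is_poly n f"
  shows "peval phi n (\<lambda>m. c * f m) x = phi c * peval phi n f x"
proof -
  have "finite {m. f m \<noteq> 0}" using assms(3) by (simp add: is_poly_def)
  then show ?thesis
    by (subst (1 2) peval_superset[of phi "{m. f m \<noteq> 0}"])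
      (auto simp: assms sum_distrib_left mult.assoc)
qed

text \<open>Products are assembled one variable at a time, so this shift of exponents is the only
  multiplication of polynomials that occurs. The test \<open>m i = 0\<close> keeps truncated
  subtraction from producing spurious monomials.\<close>

definition var_mult :: "nat \<times> nat \<Rightarrow> cpoly \<Rightarrow> cpoly" where
  "var_mult i f m = (if m i = 0 then 0 else f (m(i := m i - 1)))"

lemma var_mult_support: "{m. var_mult i f m \<noteq> 0} = (\<lambda>m. m(i := m i + 1)) ` {m. f m \<noteq> 0}"
proof (intro set_eqI iffI)
  fix m assume "m \<in> {m. var_mult i f m \<noteq> 0}"
  then have m: "m i \<noteq> 0" "f (m(i := m i - 1)) \<noteq> 0"
    by (auto simp: var_mult_def split: if_splits)
  then show "m \<in> (\<lambda>m. m(i := m i + 1)) ` {m. f m \<noteq> 0}"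
    by (intro image_eqI[of _ _ "m(i := m i - 1)"]) auto
qed (auto simp: var_mult_def)

lemma is_poly_var_mult:
  assumes "is_poly n f" "i \<in> pairs n"
  shows "is_poly n (var_mult i f)"
proof -
  have "finite {m. var_mult i f m \<noteq> 0}"
    using assms by (simp add: var_mult_support is_poly_def)
  moreover have "m j = 0" if "var_mult i f m \<noteq> 0" "j \<notin> pairs n" for m j
  proof -
    have "f (m(i := m i - 1)) \<noteq> 0"
      using that by (auto simp: var_mult_def split: if_splits)
    then have "(m(i := m i - 1)) j = 0"
      using assms(1) that(2) unfolding is_poly_def by blast
    moreover have "j \<noteq> i"
      using that(2) assms(2) by blast
    ultimately show ?thesis by simp
  qed
  ultimately show ?thesis by (simp add: is_poly_def)
qed

lemma peval_var_mult:
  assumes "i \<in> pairs n"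
  shows "peval phi n (var_mult i f) x = x i * peval phi n f x"
proof -
  have inj: "inj_on (\<lambda>m. m(i := m i + 1)) S" for S :: "(nat \<times> nat \<Rightarrow> nat) set"
  proof (rule inj_onI)
    fix m m' :: "nat \<times> nat \<Rightarrow> nat" assume eq: "m(i := m i + 1) = m'(i := m' i + 1)"
    show "m = m'"
    proof
      fix j show "m j = m' j"
        using fun_cong[OF eq, of j] by (cases "j = i") auto
    qed
  qed
  have "(\<Prod>j\<in>pairs n. x j ^ (m(i := m i + 1)) j) = x i * (\<Prod>j\<in>pairs n. x j ^ m j)" for m
    using assms by (simp add: prod.remove[OF finite_pairs] mult.assoc)
  moreover have "var_mult i f (m(i := m i + 1)) = f m" for m
    by (simp add: var_mult_def)
  ultimately show ?thesis
    unfolding peval_def var_mult_support sum.reindex[OF inj]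
    by (simp add: sum_distrib_left mult_ac del: fun_upd_apply)
qed

text \<open>A polynomial expression, recorded by its values at complex and at Laurent series points.\<close>

definition poly_expr :: "nat \<Rightarrow> ((nat \<times> nat \<Rightarrow> complex) \<Rightarrow> complex) \<Rightarrow>
    ((nat \<times> nat \<Rightarrow> complex fls) \<Rightarrow> complex fls) \<Rightarrow> bool" where
  "poly_expr n e e' \<longleftrightarrow> (\<exists>f. is_poly n f \<and> (\<forall>x. peval (\<lambda>c. c) n f x = e x) \<and>
      (\<forall>x. peval fls_const n f x = e' x))"

lemma poly_expr_zero: "poly_expr n (\<lambda>x. 0) (\<lambda>x. 0)"
  unfolding poly_expr_def by (rule exI[of _ "\<lambda>m. 0"]) (auto simp: is_poly_def peval_def)

lemma poly_expr_one: "poly_expr n (\<lambda>x. 1) (\<lambda>x. 1)"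
  unfolding poly_expr_def
  by (rule exI[of _ "\<lambda>m. if m = (\<lambda>_. 0) then 1 else 0"]) (auto simp: is_poly_def peval_def)

lemma poly_expr_add:
  assumes "poly_expr n e e'" "poly_expr n g g'"
  shows "poly_expr n (\<lambda>x. e x + g x) (\<lambda>x. e' x + g' x)"
proof -
  obtain p q where p: "is_poly n p" "\<And>x. peval (\<lambda>c. c) n p x = e x" "\<And>x. peval fls_const n p x = e' x"
    and q: "is_poly n q" "\<And>x. peval (\<lambda>c. c) n q x = g x" "\<And>x. peval fls_const n q x = g' x"
    using assms unfolding poly_expr_def by blast
  have "finite ({m. p m \<noteq> 0} \<union> {m. q m \<noteq> 0})"
    using p(1) q(1) by (simp add: is_poly_def)
  then have "finite {m. p m + q m \<noteq> 0}"
    by (rule rev_finite_subset) auto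
  moreover have "p m \<noteq> 0 \<or> q m \<noteq> 0" if "p m + q m \<noteq> 0" for m
    using that by auto
  ultimately have "is_poly n (\<lambda>m. p m + q m)"
    using p(1) q(1) unfolding is_poly_def by blast
  then show ?thesis
    unfolding poly_expr_def
    by (intro exI[of _ "\<lambda>m. p m + q m"]) (simp add: peval_add p q fls_plus_const[symmetric])
qed

lemma poly_expr_uminus:
  assumes "poly_expr n e e'"
  shows "poly_expr n (\<lambda>x. - e x) (\<lambda>x. - e' x)"
proof -
  obtain p where p: "is_poly n p" "\<And>x. peval (\<lambda>c. c) n p x = e x" "\<And>x. peval fls_const n p x = e' x"
    using assms unfolding poly_expr_def by blast
  have "is_poly n (\<lambda>m. -1 * p m)"
    using p(1) by (simp add: is_poly_def)
  moreover have "peval (\<lambda>c. c) n (\<lambda>m. -1 * p m) x = - e x" for x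
    by (subst peval_scale) (use p in auto)
  moreover have "peval fls_const n (\<lambda>m. -1 * p m) x = - e' x" for x
    by (subst peval_scale) (use p in auto)
  ultimately show ?thesis
    unfolding poly_expr_def by blast
qed

lemma poly_expr_diff:
  assumes "poly_expr n e e'" "poly_expr n g g'"
  shows "poly_expr n (\<lambda>x. e x - g x) (\<lambda>x. e' x - g' x)"
  using poly_expr_add[OF assms(1) poly_expr_uminus[OF assms(2)]] by simp

lemma poly_expr_var_mult:
  assumes "poly_expr n e e'" "i \<in> pairs n"
  shows "poly_expr n (\<lambda>x. x i * e x) (\<lambda>x. x i * e' x)"
proof -
  obtain p where p: "is_poly n p" "\<And>x. peval (\<lambda>c. c) n p x = e x" "\<And>x. peval fls_const n p x = e' x"
    using assms unfolding poly_expr_def by blast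
  then show ?thesis
    unfolding poly_expr_def
    by (intro exI[of _ "var_mult i p"]) (simp add: is_poly_var_mult peval_var_mult assms(2))
qed

definition sqdist :: "(nat \<times> nat \<Rightarrow> 'a::comm_ring_1) \<Rightarrow> nat \<Rightarrow> nat \<Rightarrow> 'a" where
  "sqdist x u v = (if u = v then 0 else x (min u v, max u v))"

text \<open>Twice the inner product of the position vectors of \<open>u\<close> and \<open>v\<close> relative to vertex \<open>1\<close>.\<close>

definition gram :: "(nat \<times> nat \<Rightarrow> 'a::comm_ring_1) \<Rightarrow> nat \<Rightarrow> nat \<Rightarrow> 'a" where
  "gram x u v = sqdist x 1 u + sqdist x 1 v - sqdist x u v"

text \<open>The minor with rows \<open>2, u, w\<close> and columns \<open>2, v, w\<close>, expanded into monomials ending in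
  \<open>1\<close> so that it is built from \<open>1\<close> by multiplications with single entries.\<close>

definition minor :: "(nat \<Rightarrow> nat \<Rightarrow> 'a::comm_ring_1) \<Rightarrow> nat \<Rightarrow> nat \<Rightarrow> nat \<Rightarrow> 'a" where
  "minor g u v w = g 2 2 * (g u v * (g w w * 1)) - g 2 2 * (g u w * (g w v * 1))
     - g 2 v * (g u 2 * (g w w * 1)) + g 2 v * (g u w * (g w 2 * 1))
     + g 2 w * (g u 2 * (g w v * 1)) - g 2 w * (g u v * (g w 2 * 1))"

lemma poly_expr_sqdist_mult:
  assumes "poly_expr n e e'" "u \<in> {1..n}" "v \<in> {1..n}"
  shows "poly_expr n (\<lambda>x. sqdist x u v * e x) (\<lambda>x. sqdist x u v * e' x)"
proof (cases "u = v")
  case True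
  then show ?thesis by (simp add: sqdist_def poly_expr_zero)
next
  case False
  then have "(min u v, max u v) \<in> pairs n"
    using assms by (auto simp: pairs_def)
  from poly_expr_var_mult[OF assms(1) this] False show ?thesis
    by (simp add: sqdist_def)
qed

lemma poly_expr_gram_mult:
  assumes "poly_expr n e e'" "u \<in> {1..n}" "v \<in> {1..n}"
  shows "poly_expr n (\<lambda>x. gram x u v * e x) (\<lambda>x. gram x u v * e' x)"
proof -
  have 1: "1 \<in> {1..n}" using assms(2) by auto
  show ?thesis
    unfolding gram_def ring_distribs
    by (intro poly_expr_add poly_expr_diff poly_expr_sqdist_mult assms 1)
qed

lemma poly_expr_minor:
  assumes "2 \<le> n" "u \<in> {1..n}" "v \<in> {1..n}" "w \<in> {1..n}"
  shows "poly_expr n (\<lambda>x. minor (gram x) u v w) (\<lambda>x. minor (gram x) u v w)"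
proof -
  have "2 \<in> {1..n}" using assms(1) by simp
  then show ?thesis
    unfolding minor_def
    by (intro poly_expr_add poly_expr_diff poly_expr_gram_mult poly_expr_one assms)
qed

text \<open>Such a \<open>g\<close> is a sum of two matrices of rank at most one, so its 3 by 3
  determinants vanish.\<close>

lemma minor_rank_two:
  assumes "\<And>u v. g u v = 2 * (a u * a v + b u * b v)"
  shows "minor g u v w = 0"
  unfolding minor_def assms by (simp add: algebra_simps)

lemma gram_euclidean:
  fixes p :: "nat \<Rightarrow> nat \<Rightarrow> real"
  shows "gram (\<lambda>i. complex_of_real (\<Sum>k<2. (p (fst i) k - p (snd i) k)^2)) u v
    = 2 * (complex_of_real (p u 0 - p 1 0) * complex_of_real (p v 0 - p 1 0)
         + complex_of_real (p u 1 - p 1 1) * complex_of_real (p v 1 - p 1 1))"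
proof -
  have sq: "sqdist (\<lambda>i. complex_of_real (\<Sum>k<2. (p (fst i) k - p (snd i) k)^2)) u v
      = complex_of_real ((p u 0 - p v 0)^2 + (p u 1 - p v 1)^2)" for u v
    by (auto simp: sqdist_def min_def max_def numeral_2_eq_2 algebra_simps)
  show ?thesis
    unfolding gram_def sq
    by (simp add: power2_eq_square algebra_simps)
qed

text \<open>One polynomial \<open>f\<close> underlies the minor at complex and at Laurent series
  points. It vanishes on all real planar configurations, so it lies in the ideal and vanishes at
  \<open>x\<close>.\<close>

lemma minor_vanishes:
  fixes x :: "nat \<times> nat \<Rightarrow> complex fls"
  assumes x: "\<And>f. f \<in> cm_ideal n 2 \<Longrightarrow> peval fls_const n f x = 0"
    and uvw: "2 \<le> n" "u \<in> {1..n}" "v \<in> {1..n}" "w \<in> {1..n}"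
  shows "minor (gram x) u v w = 0"
proof -
  obtain f where f: "is_poly n f" "\<And>x. peval (\<lambda>c. c) n f x = minor (gram x) u v w"
    "\<And>x. peval fls_const n f x = minor (gram x) u v w"
    using poly_expr_minor[OF uvw] unfolding poly_expr_def by blast
  have "f \<in> cm_ideal n 2"
    unfolding cm_ideal_def
  proof (intro CollectI conjI allI f(1))
    fix p :: "nat \<Rightarrow> nat \<Rightarrow> real"
    show "peval (\<lambda>c. c) n f (\<lambda>i. complex_of_real (\<Sum>k<2. (p (fst i) k - p (snd i) k)^2)) = 0"
      unfolding f(2) by (rule minor_rank_two, rule gram_euclidean)
  qed
  with x f(3) show ?thesis by metis
qed

section \<open>Splitting the quadratic form over Laurent series\<close>

lemma fls_compose_two_has_sqrt: "\<exists>c. c\<^sup>2 = fls_compose_power (e :: complex fls) 2"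
proof (cases "e = 0")
  case False
  \<comment> \<open>\<open>e\<close> is the monomial of degree \<open>m\<close> times a power series
    \<open>q\<close> with nonzero constant term. \<open>q\<close> has a power series root, and
    substituting s^2 for s makes the monomial, whose degree may be odd, a square.\<close>
  define m where "m = fls_subdegree e"
  define q where "q = fls_regpart (fls_shift m e)"
  define r where "r = fps_radical (\<lambda>k z. csqrt z) 2 q"
  have "fps_nth q 0 \<noteq> 0"
    using False by (simp add: q_def m_def)
  then have "r\<^sup>2 = q"
    using power_radical[of q "\<lambda>k z. csqrt z" 1]
    by (simp add: r_def power2_csqrt flip: numeral_2_eq_2 del: power_Suc)
  have "fls_subdegree (fls_shift m e) \<ge> 0"
    using False by (simp add: m_def)
  then have "fps_to_fls q = fls_shift m e"
    unfolding q_def by simp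
  then have "e = fls_shift (- m) (fps_to_fls q)"
    by simp
  also have "\<dots> = fls_X_intpow m * fps_to_fls (r * r)"
    using \<open>r\<^sup>2 = q\<close> by (simp add: fls_X_intpow_times_conv_shift power2_eq_square)
  finally have "e = fls_X_intpow m * (fps_to_fls r * fps_to_fls r)"
    by (simp only: fls_times_fps_to_fls)
  then have "fls_compose_power e 2 = fls_X_intpow (m + m) * (fls_compose_power (fps_to_fls r) 2)\<^sup>2"
    by (simp only: fls_compose_power_mult fls_compose_power_X_intpow power2_eq_square) simp
  also have "\<dots> = (fls_X_intpow m * fls_compose_power (fps_to_fls r) 2)\<^sup>2"
    by (simp only: fls_X_intpow_times_fls_X_intpow[symmetric] power2_eq_square mult_ac)
  finally show ?thesis by metis
qed (intro exI[of _ 0]; simp)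

lemma fls_subdegree_compose_power:
  assumes "d > 0" "f \<noteq> 0"
  shows "fls_compose_power f d \<noteq> 0 \<and> fls_subdegree (fls_compose_power f d) = int d * fls_subdegree f"
proof -
  have nz: "fls_nth (fls_compose_power f d) (int d * fls_subdegree f) \<noteq> 0"
    using assms by (simp add: fls_nth_compose_power)
  have "fls_nth (fls_compose_power f d) k = 0" if k: "k < int d * fls_subdegree f" for k
  proof (cases "int d dvd k")
    case True
    then obtain j where "k = int d * j" by blast
    then show ?thesis
      using assms k by (simp add: fls_nth_compose_power)
  qed (simp add: fls_nth_compose_power assms)
  with nz show ?thesis
    by (metis fls_subdegree_eqI fls_zero_nth)
qed

text \<open>The Schur complement of the entry at \<open>(2,2)\<close> has rank at most one.\<close>

lemma rank_two_distance_form: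
  fixes x :: "nat \<times> nat \<Rightarrow> complex fls"
  assumes x: "\<And>f. f \<in> cm_ideal n 2 \<Longrightarrow> peval fls_const n f x = 0"
    and n: "2 \<le> n" and x12: "x (1, 2) \<noteq> 0"
  shows "\<exists>a e \<alpha> \<beta>. a \<noteq> 0 \<and> (\<forall>u\<in>{1..n}. \<forall>v\<in>{1..n}.
           a * sqdist x u v = (\<alpha> u - \<alpha> v)\<^sup>2 - e * (\<beta> u - \<beta> v)\<^sup>2)"
proof -
  define g where "g = gram x"
  \<comment> \<open>The Schur complement multiplied by the pivot \<open>g 2 2\<close>, which avoids
    division.\<close>
  define H where "H u v = g 2 2 * g u v - g 2 u * g 2 v" for u v
  have g_sym: "g u v = g v u" for u v
    by (simp add: g_def gram_def sqdist_def min.commute max.commute)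
  have H_sym: "H u v = H v u" for u v
    unfolding H_def using g_sym[of u v] by (simp add: mult.commute)
  have g_dist: "2 * sqdist x u v = g u u + g v v - 2 * g u v" for u v
    by (simp add: g_def gram_def sqdist_def)
  \<comment> \<open>The pivot equals \<open>2 * x (1, 2)\<close>.\<close>
  have g22: "g 2 2 \<noteq> 0"
    using x12 by (simp add: g_def gram_def sqdist_def min_def max_def)
  have H_minor: "H u v * H w w = H u w * H v w" if "u \<in> {1..n}" "v \<in> {1..n}" "w \<in> {1..n}" for u v w
  proof -
    have "H u v * H w w - H u w * H w v = g 2 2 * minor g u v w"
      unfolding H_def minor_def g_sym[of u 2] g_sym[of w 2] by (simp add: algebra_simps)
    also have "\<dots> = 0"
      using minor_vanishes[OF x n that] by (simp add: g_def)
    finally show ?thesis using H_sym[of v w] by simp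
  qed
  have dist: "2 * g 2 2 * sqdist x u v = (g 2 u - g 2 v)\<^sup>2 + (H u u + H v v - 2 * H u v)" for u v
  proof -
    have "2 * g 2 2 * sqdist x u v = g 2 2 * (2 * sqdist x u v)" by (simp add: mult_ac)
    also have "\<dots> = (g 2 u - g 2 v)\<^sup>2 + (H u u + H v v - 2 * H u v)"
      unfolding g_dist H_def by (simp add: algebra_simps power2_eq_square)
    finally show ?thesis .
  qed
  have a: "2 * g 2 2 \<noteq> 0" using g22 by simp
  show ?thesis
  proof (cases "\<exists>w\<in>{1..n}. H w w \<noteq> 0")
    case True
    then obtain w where w: "w \<in> {1..n}" "H w w \<noteq> 0" by blast
    have H: "H u v = H u w * H v w / H w w" if "u \<in> {1..n}" "v \<in> {1..n}" for u v
      using H_minor[OF that w(1)] w(2) by (simp add: field_simps)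
    \<comment> \<open>A symmetric matrix of rank one with pivot \<open>H w w\<close> contributes the
      single square \<open>(H u w - H v w)^2 / H w w\<close>.\<close>
    have form: "2 * g 2 2 * sqdist x u v = (g 2 u - g 2 v)\<^sup>2 - (- (1 / H w w)) * (H u w - H v w)\<^sup>2"
      if uv: "u \<in> {1..n}" "v \<in> {1..n}" for u v
      unfolding dist H[OF uv] H[OF uv(1) uv(1)] H[OF uv(2) uv(2)]
      by (simp add: algebra_simps power2_eq_square add_divide_distrib diff_divide_distrib)
    show ?thesis
      by (intro exI[of _ "2 * g 2 2"] exI[of _ "- (1 / H w w)"] exI[of _ "g 2"] exI[of _ "\<lambda>u. H u w"]
          conjI ballI a form)
  next
    case False
    \<comment> \<open>With zero diagonal, \<open>H u v * H u v = H u u * H v v = 0\<close>.\<close>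
    have "H u v = 0" if "u \<in> {1..n}" "v \<in> {1..n}" for u v
      using H_minor[OF that(1) that(1) that(2)] False that by simp
    then have form: "2 * g 2 2 * sqdist x u v = (g 2 u - g 2 v)\<^sup>2 - 0 * (0 - 0)\<^sup>2"
      if "u \<in> {1..n}" "v \<in> {1..n}" for u v
      using that by (simp add: dist)
    show ?thesis
      by (intro exI[of _ "2 * g 2 2"] exI[of _ 0] exI[of _ "g 2"] exI[of _ "\<lambda>_. 0"]
          conjI ballI a form)
  qed
qed

text \<open>The difference of squares splits into linear factors once \<open>e\<close> is a square.
  This holds after s is replaced by s^2, that is, after passing from t^(1/N) to t^(1/(2N)).\<close>

lemma isotropic_factorization:
  fixes x :: "nat \<times> nat \<Rightarrow> complex fls"
  assumes x: "\<And>f. f \<in> cm_ideal n 2 \<Longrightarrow> peval fls_const n f x = 0"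
    and n: "2 \<le> n" and x12: "x (1, 2) \<noteq> 0"
  shows "\<exists>a X Y. a \<noteq> 0 \<and> (\<forall>u\<in>{1..n}. \<forall>v\<in>{1..n}.
           a * fls_compose_power (sqdist x u v) 2 = (X u - X v) * (Y u - Y v))"
proof -
  obtain a e \<alpha> \<beta> where a: "a \<noteq> 0" and form: "\<And>u v. u \<in> {1..n} \<Longrightarrow> v \<in> {1..n} \<Longrightarrow>
           a * sqdist x u v = (\<alpha> u - \<alpha> v)\<^sup>2 - e * (\<beta> u - \<beta> v)\<^sup>2"
    using rank_two_distance_form[OF assms] by blast
  obtain c where c: "c\<^sup>2 = fls_compose_power e 2"
    using fls_compose_two_has_sqrt by blast
  let ?s = "\<lambda>f :: complex fls. fls_compose_power f 2"
  define X where "X u = ?s (\<alpha> u) - c * ?s (\<beta> u)" for u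
  define Y where "Y u = ?s (\<alpha> u) + c * ?s (\<beta> u)" for u
  have "?s a * ?s (sqdist x u v) = (X u - X v) * (Y u - Y v)" if uv: "u \<in> {1..n}" "v \<in> {1..n}" for u v
  proof -
    have "?s a * ?s (sqdist x u v) = ?s (a * sqdist x u v)"
      by simp
    also have "\<dots> = (?s (\<alpha> u) - ?s (\<alpha> v))\<^sup>2 - c\<^sup>2 * (?s (\<beta> u) - ?s (\<beta> v))\<^sup>2"
      unfolding form[OF uv] c by (simp add: power2_eq_square)
    also have "\<dots> = (X u - X v) * (Y u - Y v)"
      unfolding X_def Y_def by (simp add: algebra_simps power2_eq_square)
    finally show ?thesis .
  qed
  moreover have "?s a \<noteq> 0"
    using fls_subdegree_compose_power[of 2 a] a by simp
  ultimately show ?thesis by blast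
qed

section \<open>Ultrametrics\<close>

text \<open>\<open>e\<close> is an order of vanishing, large for close points, so \<open>- e\<close>
  satisfies the usual ultrametric inequality. Only distinct points are compared, since the diagonal
  carries no information: \<open>fls_subdegree 0\<close> is 0 rather than infinite.\<close>

definition ultrametric_on :: "nat \<Rightarrow> (nat \<Rightarrow> nat \<Rightarrow> int) \<Rightarrow> bool" where
  "ultrametric_on n e \<longleftrightarrow> (\<forall>u\<in>{1..n}. \<forall>v\<in>{1..n}. e u v = e v u) \<and>
     (\<forall>u\<in>{1..n}. \<forall>v\<in>{1..n}. \<forall>w\<in>{1..n}. u \<noteq> v \<longrightarrow> u \<noteq> w \<longrightarrow> v \<noteq> w \<longrightarrow> min (e u w) (e w v) \<le> e u v)"

lemma ultrametric_on_sym: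
  assumes "ultrametric_on n e" "u \<in> {1..n}" "v \<in> {1..n}"
  shows "e u v = e v u"
  by (rule assms(1)[unfolded ultrametric_on_def, THEN conjunct1, rule_format, OF assms(2,3)])

lemma ultrametric_on_triangle:
  assumes "ultrametric_on n e" "u \<in> {1..n}" "v \<in> {1..n}" "w \<in> {1..n}" "u \<noteq> v" "u \<noteq> w" "v \<noteq> w"
  shows "min (e u w) (e w v) \<le> e u v"
  by (rule assms(1)[unfolded ultrametric_on_def, THEN conjunct2, rule_format, OF assms(2-)])

text \<open>An ultrametric ball; its centre is added by hand because \<open>e u u\<close> is
  arbitrary. By the strict inequality, \<open>u\<close> and \<open>v\<close> are separated exactly
  from level \<open>e u v\<close> on.\<close>

definition cluster :: "nat \<Rightarrow> (nat \<Rightarrow> nat \<Rightarrow> int) \<Rightarrow> int \<Rightarrow> nat \<Rightarrow> nat set" where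
  "cluster n e k u = {v \<in> {1..n}. v = u \<or> e u v > k}"

text \<open>The ultrametric inequality through the second point gives one inclusion; exchanging the
  two points gives the other.\<close>

lemma cluster_eq:
  assumes "ultrametric_on n e" "u \<in> {1..n}" "v \<in> cluster n e k u"
  shows "cluster n e k v = cluster n e k u"
proof -
  have sub: "cluster n e k v \<subseteq> cluster n e k u" if "u \<in> {1..n}" "v \<in> cluster n e k u" for u v
  proof
    fix w assume w: "w \<in> cluster n e k v"
    show "w \<in> cluster n e k u"
    proof (cases "w = u \<or> w = v \<or> u = v")
      case False
      then have "min (e u v) (e v w) \<le> e u w"
        using ultrametric_on_triangle[OF assms(1), of u w v] that w by (simp add: cluster_def)
      then show ?thesis using False that w by (auto simp: cluster_def)
    qed (use that w in \<open>auto simp: cluster_def\<close>)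
  qed
  have "e v u = e u v"
    using ultrametric_on_sym[OF assms(1)] assms(2,3) by (simp add: cluster_def)
  then have "u \<in> cluster n e k v" "v \<in> {1..n}"
    using assms(2,3) by (auto simp: cluster_def)
  then show ?thesis
    using sub assms(2,3) by blast
qed

lemma cluster_self: "u \<in> {1..n} \<Longrightarrow> u \<in> cluster n e k u"
  by (simp add: cluster_def)

lemma cluster_antimono: "k \<le> k' \<Longrightarrow> cluster n e k' u \<subseteq> cluster n e k u"
  by (auto simp: cluster_def)

text \<open>Layer-cake formula: the coefficient of \<open>A\<close> counts the levels at which \<open>A\<close> is a cluster.\<close>

lemma ultrametric_tree:
  assumes e: "ultrametric_on n e" and n: "2 \<le> n"
  shows "\<exists>T l m. rooted_tree_on n T \<and> (\<forall>A. 0 \<le> l A) \<and> (\<forall>u\<in>{1..n}. \<forall>v\<in>{1..n}. u \<noteq> v \<longrightarrow>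
           real_of_int (e u v) = m + clique_sum (clades T - {{1..n}}) l u v)"
proof -
  define E where "E = {e u v | u v. u \<in> {1..n} \<and> v \<in> {1..n} \<and> u \<noteq> v}"
  have "E \<subseteq> (\<lambda>(u, v). e u v) ` ({1..n} \<times> {1..n})"
    unfolding E_def by auto
  then have finE: "finite E"
    by (rule finite_subset) simp
  have "e 1 2 \<in> E"
    unfolding E_def using n by force
  then have neE: "E \<noteq> {}" by blast
  \<comment> \<open>Below \<open>Min E\<close> the only cluster is \<open>{1..n}\<close>, which is
    accounted for by the constant \<open>Min E\<close>; from \<open>Max E\<close> on all clusters
    are singletons.\<close>
  define K where "K = {Min E..<Max E}"
  define L where "L = insert {1..n} {cluster n e k u | k u. k \<in> K \<and> u \<in> {1..n} \<and> 2 \<le> card (cluster n e k u)}"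
  define l where "l A = real (card {k \<in> K. \<exists>u\<in>{1..n}. A = cluster n e k u})" for A
  have sub: "cluster n e k u \<subseteq> {1..n}" for k u
    by (auto simp: cluster_def)
  have L_sub: "A \<subseteq> {1..n}" "2 \<le> card A" if "A \<in> L" for A
    using that n sub unfolding L_def by auto
  have nest: "cluster n e k u \<subseteq> cluster n e k' u' \<or> cluster n e k' u' \<subseteq> cluster n e k u
      \<or> cluster n e k u \<inter> cluster n e k' u' = {}" if u: "u \<in> {1..n}" "u' \<in> {1..n}" for k u k' u'
  proof (cases "cluster n e k u \<inter> cluster n e k' u' = {}")
    case False
    then obtain w where "w \<in> cluster n e k u" "w \<in> cluster n e k' u'" by blast
    then have "cluster n e k u = cluster n e k w" "cluster n e k' u' = cluster n e k' w"
      using cluster_eq[OF e] u by metis+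
    then show ?thesis
      using cluster_antimono[of k k' n e w] cluster_antimono[of k' k n e w] by (cases "k \<le> k'") auto
  qed blast
  have "laminar L"
    unfolding laminar_def
  proof (intro ballI)
    fix A B assume AB: "A \<in> L" "B \<in> L"
    show "A \<subseteq> B \<or> B \<subseteq> A \<or> A \<inter> B = {}"
    proof (cases "A = {1..n} \<or> B = {1..n}")
      case True
      then show ?thesis using L_sub AB by blast
    next
      case False
      then obtain k u k' u' where "A = cluster n e k u" "u \<in> {1..n}" "B = cluster n e k' u'" "u' \<in> {1..n}"
        using AB unfolding L_def by auto
      then show ?thesis using nest by metis
    qed
  qed
  then have "\<exists>T. wf_rtree T \<and> distinct (leaves T) \<and> set (leaves T) = {1..n} \<and> clades T = L"
  proof (rule exists_rtree_of_laminar[rotated 2])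
    show "A \<subseteq> {1..n} \<and> 2 \<le> card A" if "A \<in> L" for A
      using L_sub that by blast
    show "{1..n} \<in> L" by (simp add: L_def)
  qed (use n in auto)
  then obtain T where T: "rooted_tree_on n T" "clades T = L"
    unfolding rooted_tree_on_def by blast
  have finL: "finite L"
    using L_sub(1) by (intro finite_subset[of L "Pow {1..n}"]) auto
  \<comment> \<open>A pair at which \<open>e\<close> attains its minimum is separated at every level
    of \<open>K\<close>.\<close>
  have proper: "cluster n e k u \<noteq> {1..n}" if k: "k \<in> K" and u: "u \<in> {1..n}" for k u
  proof
    assume eq: "cluster n e k u = {1..n}"
    obtain a b where ab: "a \<in> {1..n}" "b \<in> {1..n}" "a \<noteq> b" "e a b = Min E"
      using Min_in[OF finE neE] unfolding E_def by force
    then have "cluster n e k a = {1..n}"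
      using cluster_eq[OF e u, of a k] eq by simp
    then have "b \<in> cluster n e k a" using ab by simp
    then have "e a b > k" using ab by (simp add: cluster_def)
    with ab(4) k show False by (simp add: K_def)
  qed
  have "real_of_int (e u v) = real_of_int (Min E) + clique_sum (L - {{1..n}}) l u v"
    if uv: "u \<in> {1..n}" "v \<in> {1..n}" "u \<noteq> v" for u v
  proof -
    have inE: "e u v \<in> E" unfolding E_def using uv by blast
    have finK: "finite K" by (simp add: K_def)
    have l: "l A = (\<Sum>k\<in>K. of_bool (\<exists>w\<in>{1..n}. A = cluster n e k w))" for A
      using finK by (simp add: l_def of_bool_def sum.If_cases Int_def)
    have "clique_sum (L - {{1..n}}) l u v
        = (\<Sum>A\<in>L - {{1..n}}. \<Sum>k\<in>K. of_bool (\<exists>w\<in>{1..n}. A = cluster n e k w) * of_bool (u \<in> A \<and> v \<in> A))"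
      unfolding clique_sum_def l sum_distrib_right ..
    also have "\<dots> = (\<Sum>k\<in>K. \<Sum>A\<in>L - {{1..n}}. of_bool (\<exists>w\<in>{1..n}. A = cluster n e k w) * of_bool (u \<in> A \<and> v \<in> A))"
      by (rule sum.swap)
    \<comment> \<open>Clusters of one level are disjoint, so only the cluster of \<open>u\<close>
      can count, and it contains \<open>v\<close> exactly when \<open>k < e u v\<close>.\<close>
    also have "\<dots> = (\<Sum>k\<in>K. of_bool (k < e u v))"
    proof (rule sum.cong[OF refl])
      fix k assume k: "k \<in> K"
      have "(\<Sum>A\<in>L - {{1..n}}. of_bool (\<exists>w\<in>{1..n}. A = cluster n e k w) * of_bool (u \<in> A \<and> v \<in> A))
          = (\<Sum>A\<in>L - {{1..n}}. if A = cluster n e k u then of_bool (k < e u v) else (0::real))"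
      proof (rule sum.cong[OF refl])
        fix A assume "A \<in> L - {{1..n}}"
        show "of_bool (\<exists>w\<in>{1..n}. A = cluster n e k w) * of_bool (u \<in> A \<and> v \<in> A)
            = (if A = cluster n e k u then of_bool (k < e u v) else (0::real))"
        proof (cases "A = cluster n e k u")
          case True
          have "v \<in> A \<longleftrightarrow> k < e u v" "u \<in> A"
            using uv by (simp_all add: True cluster_def)
          moreover have "\<exists>w\<in>{1..n}. A = cluster n e k w"
            using True uv(1) by blast
          ultimately show ?thesis using True by simp
        next
          case False
          then have "\<not> ((\<exists>w\<in>{1..n}. A = cluster n e k w) \<and> u \<in> A)"
            using cluster_eq[OF e] by blast
          then show ?thesis using False by auto
        qed
      qed
      also have "\<dots> = of_bool (k < e u v)"
      proof (cases "k < e u v")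
        case True
        then have "{u, v} \<subseteq> cluster n e k u"
          using uv by (auto simp: cluster_def)
        then have "2 \<le> card (cluster n e k u)"
          using card_mono[of "cluster n e k u" "{u, v}"] uv(3) finite_subset[OF sub] by auto
        then have "cluster n e k u \<in> L - {{1..n}}"
          using k uv(1) proper unfolding L_def by blast
        then show ?thesis using finL by simp
      qed simp
      finally show "(\<Sum>A\<in>L - {{1..n}}. of_bool (\<exists>w\<in>{1..n}. A = cluster n e k w) * of_bool (u \<in> A \<and> v \<in> A))
          = (of_bool (k < e u v) :: real)" .
    qed
    also have "\<dots> = real (card {k \<in> K. k < e u v})"
      using finK by (simp add: of_bool_def sum.If_cases Int_def)
    also have "{k \<in> K. k < e u v} = {Min E..<e u v}"
      using Max_ge[OF finE inE] by (auto simp: K_def)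
    also have "real (card {Min E..<e u v}) = real_of_int (e u v) - real_of_int (Min E)"
      using Min_le[OF finE inE] by simp
    finally show ?thesis by simp
  qed
  then have "rooted_tree_on n T \<and> (\<forall>A. 0 \<le> l A) \<and> (\<forall>u\<in>{1..n}. \<forall>v\<in>{1..n}. u \<noteq> v \<longrightarrow>
           real_of_int (e u v) = real_of_int (Min E) + clique_sum (clades T - {{1..n}}) l u v)"
    using T by (simp add: l_def)
  then show ?thesis by blast
qed

text \<open>The \<open>k\<close>-th coefficient of the series at \<open>u\<close> names the cluster of \<open>u\<close> at level \<open>k\<close>.\<close>

lemma ultrametric_realizable:
  assumes e: "ultrametric_on n e" and nonneg: "\<And>u v. 0 \<le> e u v"
  shows "\<exists>X :: nat \<Rightarrow> complex fls. \<forall>u\<in>{1..n}. \<forall>v\<in>{1..n}. u \<noteq> v \<longrightarrow>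
           X u \<noteq> X v \<and> fls_subdegree (X u - X v) = e u v"
proof -
  \<comment> \<open>The minimum is a canonical label of a cluster: equal clusters share it, disjoint
    ones do not. Hence \<open>X u\<close> and \<open>X v\<close> agree below degree
    \<open>e u v\<close> and differ there.\<close>
  define X :: "nat \<Rightarrow> complex fls"
    where "X u = fps_to_fls (Abs_fps (\<lambda>k. of_nat (Min (cluster n e (int k) u))))" for u
  have "X u \<noteq> X v \<and> fls_subdegree (X u - X v) = e u v" if uv: "u \<in> {1..n}" "v \<in> {1..n}" "u \<noteq> v" for u v
  proof -
    have fin: "finite (cluster n e k w)" for k w
      by (simp add: cluster_def)
    have nth: "fls_nth (X u - X v) k = (if k < 0 then 0 else
        of_nat (Min (cluster n e k u)) - of_nat (Min (cluster n e k v)))" for k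
      by (simp add: X_def)
    have low: "fls_nth (X u - X v) k = 0" if k: "k < e u v" for k
    proof -
      have "v \<in> cluster n e k u" using k uv by (simp add: cluster_def)
      then show ?thesis unfolding nth using cluster_eq[OF e uv(1)] by simp
    qed
    have "Min (cluster n e (e u v) u) \<noteq> Min (cluster n e (e u v) v)"
    proof
      let ?m = "Min (cluster n e (e u v) u)"
      assume eq: "?m = Min (cluster n e (e u v) v)"
      have m: "?m \<in> cluster n e (e u v) u" "?m \<in> cluster n e (e u v) v"
        using Min_in[OF fin] cluster_self uv eq by (metis empty_iff)+
      have "cluster n e (e u v) u = cluster n e (e u v) v"
        using cluster_eq[OF e uv(1) m(1)] cluster_eq[OF e uv(2) m(2)] by simp
      then have "v \<in> cluster n e (e u v) u"
        using cluster_self[OF uv(2)] by simp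
      then show False using uv(3) by (simp add: cluster_def)
    qed
    then have high: "fls_nth (X u - X v) (e u v) \<noteq> 0"
      unfolding nth using nonneg[of u v] by simp
    then have "X u - X v \<noteq> 0" by (metis fls_zero_nth)
    then show ?thesis
      using fls_subdegree_eqI[of "X u - X v" "e u v"] low high by auto
  qed
  then show ?thesis by blast
qed

lemma subdegree_ultrametric:
  fixes X :: "nat \<Rightarrow> complex fls"
  assumes "\<And>u v. u \<in> {1..n} \<Longrightarrow> v \<in> {1..n} \<Longrightarrow> u \<noteq> v \<Longrightarrow> X u \<noteq> X v"
  shows "ultrametric_on n (\<lambda>u v. fls_subdegree (X u - X v))"
  unfolding ultrametric_on_def
proof (intro conjI ballI impI)
  fix u v w assume uvw: "u \<in> {1..n}" "v \<in> {1..n}" "w \<in> {1..n}" "u \<noteq> v"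
  have "X u - X v = (X u - X w) + (X w - X v)" by simp
  then show "min (fls_subdegree (X u - X w)) (fls_subdegree (X w - X v)) \<le> fls_subdegree (X u - X v)"
    using fls_plus_subdegree[of "X u - X w" "X w - X v"] assms[of u v] uvw by simp
qed (rule fls_subdegree_minus_sym)

text \<open>Two sets through \<open>w\<close>, one containing \<open>u\<close> but not
  \<open>v\<close>, the other \<open>v\<close> but not \<open>u\<close>, cannot both be in
  \<open>L\<close>. So for one of the edges \<open>uw\<close>, \<open>wv\<close> every member
  containing it also contains \<open>uv\<close>, and the sums compare term by term.\<close>

lemma laminar_ultrametric:
  assumes L: "laminar L" "finite L" and a: "\<And>A. A \<in> L \<Longrightarrow> (0::int) \<le> a A"
  shows "ultrametric_on n (clique_sum L a)"
  unfolding ultrametric_on_def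
proof (intro conjI ballI impI)
  fix u v show "clique_sum L a u v = clique_sum L a v u"
    by (simp add: clique_sum_def conj_commute)
next
  have mono: "clique_sum L a u w \<le> clique_sum L a u' w'"
    if "\<And>A. A \<in> L \<Longrightarrow> u \<in> A \<Longrightarrow> w \<in> A \<Longrightarrow> u' \<in> A \<and> w' \<in> A" for u w u' w'
    unfolding clique_sum_def using that a by (intro sum_mono) (auto simp: of_bool_def)
  fix u v w
  have "(\<forall>A\<in>L. u \<in> A \<and> w \<in> A \<longrightarrow> v \<in> A) \<or> (\<forall>A\<in>L. w \<in> A \<and> v \<in> A \<longrightarrow> u \<in> A)"
    using L(1) unfolding laminar_def by blast
  then have "clique_sum L a u w \<le> clique_sum L a u v \<or> clique_sum L a w v \<le> clique_sum L a u v"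
    using mono by meson
  then show "min (clique_sum L a u w) (clique_sum L a w v) \<le> clique_sum L a u v"
    by auto
qed

section \<open>The fan\<close>

text \<open>The sign is that of \<open>val\<close>, the negative of the order of vanishing.\<close>

definition ray :: "nat set \<Rightarrow> nat \<times> nat \<Rightarrow> real" where
  "ray A i = - of_bool (fst i \<in> A \<and> snd i \<in> A)"

lemma sum_ray: "(\<Sum>A\<in>F. lam A * ray A i) = - clique_sum F lam (fst i) (snd i)"
  by (simp add: clique_sum_def ray_def sum_negf)

lemma qcone_ray: "w \<in> qcone n ray F \<longleftrightarrow> (\<exists>lam mu. (\<forall>A\<in>F. 0 \<le> lam A) \<and>
    (\<forall>i. w i = (if i \<in> pairs n then mu - clique_sum F lam (fst i) (snd i) else 0)))"
  by (simp only: qcone_def sum_ray mem_Collect_eq uminus_add_conv_diff)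

lemma qcone_rayE:
  assumes "w \<in> qcone n ray F"
  obtains lam mu where "\<And>A. A \<in> F \<Longrightarrow> 0 \<le> lam A"
    "\<And>i. w i = (if i \<in> pairs n then mu - clique_sum F lam (fst i) (snd i) else 0)"
proof -
  from assms obtain lam mu where lam: "\<forall>A\<in>F. 0 \<le> lam A"
    and w: "\<forall>i. w i = (if i \<in> pairs n then mu - clique_sum F lam (fst i) (snd i) else 0)"
    unfolding qcone_ray by (elim exE conjE)
  show thesis
  proof (rule that)
    show "0 \<le> lam A" if "A \<in> F" for A
      using lam that by (rule bspec)
    show "w i = (if i \<in> pairs n then mu - clique_sum F lam (fst i) (snd i) else 0)" for i
      using w by (rule spec)
  qed
qed

lemma qcone_rayI:
  assumes "\<And>A. A \<in> F \<Longrightarrow> 0 \<le> lam A"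
    "\<And>i. w i = (if i \<in> pairs n then mu - clique_sum F lam (fst i) (snd i) else 0)"
  shows "w \<in> qcone n ray F"
  unfolding qcone_ray by (rule exI[of _ lam], rule exI[of _ mu]) (use assms in simp)

lemma clique_sum_restrict:
  assumes "finite W" "F \<subseteq> W" "\<And>A. A \<in> F \<Longrightarrow> l A = lam A" "\<And>A. A \<in> W - F \<Longrightarrow> l A = 0"
  shows "clique_sum W l u v = clique_sum F lam u v"
proof -
  have "clique_sum F lam u v = clique_sum F l u v"
    unfolding clique_sum_def using assms(3) by (intro sum.cong) auto
  also have "\<dots> = clique_sum W l u v"
    unfolding clique_sum_def using assms(1,2,4) by (intro sum.mono_neutral_left) auto
  finally show ?thesis ..
qed

lemma qcone_mono:
  assumes "finite G" "F \<subseteq> G"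
  shows "qcone n ray F \<subseteq> qcone n ray G"
proof
  fix w assume "w \<in> qcone n ray F"
  then obtain lam mu where lam: "\<And>A. A \<in> F \<Longrightarrow> 0 \<le> lam A"
    "\<And>i. w i = (if i \<in> pairs n then mu - clique_sum F lam (fst i) (snd i) else 0)"
    by (rule qcone_rayE) (rule that)
  let ?l = "\<lambda>A. if A \<in> F then lam A else 0"
  have "clique_sum G ?l u v = clique_sum F lam u v" for u v
    by (rule clique_sum_restrict) (use assms in auto)
  then show "w \<in> qcone n ray G"
    using lam by (intro qcone_rayI[of _ ?l _ _ mu]) auto
qed

lemma TP_props:
  assumes "F \<in> TP n" "2 \<le> n"
  obtains L M where "F = L \<union> M" "laminar L" "laminar M" "finite L" "finite M"
    "\<And>A. A \<in> F \<Longrightarrow> A \<subseteq> {1..n}" "\<And>A. A \<in> F \<Longrightarrow> 2 \<le> card A" "finite F"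
proof -
  obtain T1 T2 where F: "F = clades T1 \<union> clades T2" and T: "rooted_tree_on n T1" "rooted_tree_on n T2"
    using assms(1) unfolding TP_def by blast
  have p: "laminar (clades T)" "\<forall>A\<in>clades T. A \<subseteq> {1..n} \<and> 2 \<le> card A" "finite (clades T)"
    if "rooted_tree_on n T" for T
  proof -
    show *: "laminar (clades T)" "\<forall>A\<in>clades T. A \<subseteq> {1..n} \<and> 2 \<le> card A"
      using clades_props[of T] that by (auto simp: rooted_tree_on_def)
    show "finite (clades T)"
      by (rule finite_subset[of _ "Pow {1..n}"]) (use * in auto)
  qed
  show thesis
    by (rule that[OF F]) (use p[OF T(1)] p[OF T(2)] F in auto)
qed

text \<open>A common finite index set for the coefficients of different faces.\<close>

definition big_subsets :: "nat \<Rightarrow> nat set set" where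
  "big_subsets n = {A. A \<subseteq> {1..n} \<and> 2 \<le> card A}"

lemma finite_big_subsets: "finite (big_subsets n)"
  by (simp add: big_subsets_def)

text \<open>The root clade turns an arbitrary constant into a clique sum, on both sides of an equation.\<close>

lemma clique_sum_unique_TP:
  fixes lam lam' :: "nat set \<Rightarrow> real"
  assumes n: "2 \<le> n" and F: "F \<in> TP n" and G: "G \<in> TP n"
    and nonneg: "\<And>A. A \<in> F - {{1..n}} \<Longrightarrow> 0 \<le> lam A" "\<And>A. A \<in> G - {{1..n}} \<Longrightarrow> 0 \<le> lam' A"
    and eq: "\<And>i. i \<in> pairs n \<Longrightarrow> mu - clique_sum (F - {{1..n}}) lam (fst i) (snd i)
        = mu' - clique_sum (G - {{1..n}}) lam' (fst i) (snd i)"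
    and A: "A \<in> big_subsets n" "A \<noteq> {1..n}"
  shows "(if A \<in> F then lam A else 0) = (if A \<in> G then lam' A else 0)"
proof -
  let ?N = "{1..n}"
  \<comment> \<open>The root clade gets the weight \<open>?m - mu\<close> or
    \<open>?m - mu'\<close>; the maximum makes both nonnegative, as \<open>clique_sum_unique\<close>
    demands.\<close>
  let ?m = "max mu mu'"
  define l where "l F lam mu A = (if A = ?N then ?m - mu else if A \<in> F then lam A else (0::real))"
    for F lam and mu :: real and A
  have N: "?N \<in> big_subsets n"
    using n by (simp add: big_subsets_def)
  have l_sum: "clique_sum (big_subsets n) (l F lam mu) u v = ?m - (mu - clique_sum (F - {?N}) lam u v)"
    if F: "F \<in> TP n" and uv: "u \<in> ?N" "v \<in> ?N" for F lam mu u v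
  proof -
    have sub: "F - {?N} \<subseteq> big_subsets n - {?N}"
      using TP_props[OF F n] unfolding big_subsets_def by blast
    have "clique_sum (big_subsets n) (l F lam mu) u v
        = l F lam mu ?N + clique_sum (big_subsets n - {?N}) (l F lam mu) u v"
      unfolding clique_sum_def using uv N finite_big_subsets by (subst sum.remove[of _ ?N]) auto
    moreover have "clique_sum (big_subsets n - {?N}) (l F lam mu) u v = clique_sum (F - {?N}) lam u v"
      by (rule clique_sum_restrict) (use sub finite_big_subsets in \<open>auto simp: l_def\<close>)
    moreover have "l F lam mu ?N = ?m - mu" by (simp add: l_def)
    ultimately show ?thesis by simp
  qed
  obtain L1 L2 where L: "F = L1 \<union> L2" "laminar L1" "laminar L2" "\<And>A. A \<in> F \<Longrightarrow> A \<subseteq> ?N"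
    using TP_props[OF F n] by metis
  obtain M1 M2 where M: "G = M1 \<union> M2" "laminar M1" "laminar M2" "\<And>A. A \<in> G \<Longrightarrow> A \<subseteq> ?N"
    using TP_props[OF G n] by metis
  have ins: "laminar (insert ?N L)" if "laminar L" "\<And>A. A \<in> L \<Longrightarrow> A \<subseteq> ?N" for L
    using that unfolding laminar_def by auto
  have "l F lam mu A = l G lam' mu' A"
  proof (rule clique_sum_unique[where W = "big_subsets n" and ?L1.0 = "insert ?N L1" and ?L2.0 = L2
        and ?M1.0 = "insert ?N M1" and ?M2.0 = M2])
    show "clique_sum (big_subsets n) (l F lam mu) u v = clique_sum (big_subsets n) (l G lam' mu') u v"
      if "u \<noteq> v" for u v
    proof (cases "u \<in> ?N \<and> v \<in> ?N")
      case True
      have sym: "clique_sum W l u v = clique_sum W l v u" for W and l :: "nat set \<Rightarrow> real" and u v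
        by (simp add: clique_sum_def conj_commute)
      have "(min u v, max u v) \<in> pairs n"
        using True that by (auto simp: pairs_def min_def max_def)
      from eq[OF this] have "mu - clique_sum (F - {?N}) lam u v = mu' - clique_sum (G - {?N}) lam' u v"
        using sym by (auto simp: min_def max_def split: if_splits)
      with l_sum[OF F] l_sum[OF G] True show ?thesis by simp
    next
      case False
      then have "clique_sum (big_subsets n) l u v = 0" for l :: "nat set \<Rightarrow> real"
        unfolding clique_sum_def by (intro sum.neutral) (auto simp: big_subsets_def of_bool_def)
      then show ?thesis by simp
    qed
    show "0 \<le> l F lam mu A" for A
      using nonneg(1) by (simp add: l_def)
    show "0 \<le> l G lam' mu' A" for A
      using nonneg(2) by (simp add: l_def)
    show "A \<in> insert ?N L1 \<union> L2" if "l F lam mu A \<noteq> 0" for A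
      using that L(1) by (auto simp: l_def split: if_splits)
    show "A \<in> insert ?N M1 \<union> M2" if "l G lam' mu' A \<noteq> 0" for A
      using that M(1) by (auto simp: l_def split: if_splits)
    show "laminar (insert ?N L1)" "laminar (insert ?N M1)"
      using ins L M by auto
  qed (use L M A finite_big_subsets in \<open>auto simp: big_subsets_def\<close>)
  with A(2) show ?thesis by (simp add: l_def)
qed

text \<open>The positive and negative parts of a linear relation are two nonnegative combinations
  over one face that agree up to a constant. Uniqueness equates their coefficients, and
  \<open>max c 0 = max (- c) 0\<close> forces \<open>c = 0\<close>.\<close>

lemma indep_ray:
  assumes "F \<in> TP n" "2 \<le> n"
  shows "indep_mod_ones n ray (F - {{1..n}})"
  unfolding indep_mod_ones_def sum_ray
proof (intro allI impI ballI)
  let ?F = "F - {{1..n}}"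
  fix lam :: "nat set \<Rightarrow> real" and mu A
  assume rel: "\<forall>i\<in>pairs n. - clique_sum ?F lam (fst i) (snd i) + mu = 0" and A: "A \<in> ?F"
  have "clique_sum ?F (\<lambda>A. max (lam A) 0) u v - clique_sum ?F (\<lambda>A. max (- lam A) 0) u v
      = clique_sum ?F lam u v" for u v
    unfolding clique_sum_def sum_subtractf[symmetric] by (intro sum.cong) (auto simp: max_def)
  then have eq: "mu - clique_sum ?F (\<lambda>A. max (lam A) 0) (fst i) (snd i)
      = 0 - clique_sum ?F (\<lambda>A. max (- lam A) 0) (fst i) (snd i)" if "i \<in> pairs n" for i
    using rel that by (smt (verit))
  have big: "A \<in> big_subsets n"
    using TP_props[OF assms] A unfolding big_subsets_def by blast
  have "(if A \<in> F then max (lam A) 0 else 0) = (if A \<in> F then max (- lam A) 0 else 0)"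
    by (rule clique_sum_unique_TP[OF assms(2,1,1) _ _ eq big]) (use A in simp_all)
  then show "lam A = 0"
    using A by (auto simp: max_def split: if_splits)
qed

text \<open>A common point has the same coefficients with respect to both faces, so a clade of
  \<open>F\<close> outside \<open>G\<close> has coefficient 0.\<close>

lemma qcone_Int:
  assumes n: "2 \<le> n" and F: "F \<in> TP n" and G: "G \<in> TP n"
  shows "qcone n ray (F - {{1..n}}) \<inter> qcone n ray (G - {{1..n}}) = qcone n ray ((F \<inter> G) - {{1..n}})"
proof
  have fin: "finite F" "finite G"
    using TP_props[OF F n] TP_props[OF G n] by blast+
  show "qcone n ray ((F \<inter> G) - {{1..n}}) \<subseteq> qcone n ray (F - {{1..n}}) \<inter> qcone n ray (G - {{1..n}})"
    using fin by (intro Int_greatest qcone_mono) auto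
  show "qcone n ray (F - {{1..n}}) \<inter> qcone n ray (G - {{1..n}}) \<subseteq> qcone n ray ((F \<inter> G) - {{1..n}})"
  proof
    fix w assume w: "w \<in> qcone n ray (F - {{1..n}}) \<inter> qcone n ray (G - {{1..n}})"
    then obtain lam mu where lam: "\<And>A. A \<in> F - {{1..n}} \<Longrightarrow> 0 \<le> lam A"
      "\<And>i. w i = (if i \<in> pairs n then mu - clique_sum (F - {{1..n}}) lam (fst i) (snd i) else 0)"
      by (elim IntE qcone_rayE) (rule that)
    from w obtain lam' mu' where lam': "\<And>A. A \<in> G - {{1..n}} \<Longrightarrow> 0 \<le> lam' A"
      "\<And>i. w i = (if i \<in> pairs n then mu' - clique_sum (G - {{1..n}}) lam' (fst i) (snd i) else 0)"
      by (elim IntE qcone_rayE) (rule that)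
    have "lam A = 0" if "A \<in> F - {{1..n}}" "A \<notin> G" for A
    proof -
      have "A \<in> big_subsets n"
        using TP_props[OF F n] that(1) unfolding big_subsets_def by blast
      then have "(if A \<in> F then lam A else 0) = (if A \<in> G then lam' A else 0)"
      proof (rule clique_sum_unique_TP[OF n F G, rotated 3])
        show "mu - clique_sum (F - {{1..n}}) lam (fst i) (snd i)
            = mu' - clique_sum (G - {{1..n}}) lam' (fst i) (snd i)" if "i \<in> pairs n" for i
          using lam(2) lam'(2) that by metis
      qed (use lam lam' that in auto)
      then show ?thesis using that by simp
    qed
    then have "clique_sum (F - {{1..n}}) lam u v = clique_sum ((F \<inter> G) - {{1..n}}) lam u v" for u v
      using fin by (intro clique_sum_restrict) auto
    then show "w \<in> qcone n ray ((F \<inter> G) - {{1..n}})"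
      using lam by (intro qcone_rayI[of _ lam _ _ mu]) auto
  qed
qed

section \<open>Tropical points lie in the cones\<close>

lemma qcone_Un:
  assumes "finite F" "finite G" "\<And>A. 0 \<le> l A" "\<And>A. 0 \<le> l' A"
    and w: "\<And>i. w i = (if i \<in> pairs n
      then mu - clique_sum F l (fst i) (snd i) - clique_sum G l' (fst i) (snd i) else 0)"
  shows "w \<in> qcone n ray (F \<union> G)"
proof -
  let ?l = "\<lambda>A. of_bool (A \<in> F) * l A + of_bool (A \<in> G) * l' A"
  have "clique_sum (F \<union> G) ?l u v
      = clique_sum (F \<union> G) (\<lambda>A. of_bool (A \<in> F) * l A) u v + clique_sum (F \<union> G) (\<lambda>A. of_bool (A \<in> G) * l' A) u v"
    for u v
    unfolding clique_sum_def by (simp add: distrib_right sum.distrib)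
  also have "\<dots> u v = clique_sum F l u v + clique_sum G l' u v" for u v
    using assms(1,2) by (intro arg_cong2[where f = "(+)"] clique_sum_restrict) auto
  finally show ?thesis
    using assms(3,4) w by (intro qcone_rayI[of _ ?l _ _ mu]) simp_all
qed

text \<open>The orders of \<open>X u - X v\<close> and of \<open>Y u - Y v\<close> are two
  ultrametrics, and their trees span the face. Their sum is twice the order of the entry of
  \<open>x\<close> plus the order of \<open>a\<close>.\<close>

lemma trop_pts_subset:
  assumes n: "2 \<le> n"
  shows "trop_pts n (cm_ideal n 2) \<subseteq> (\<Union>F\<in>TP n. qcone n ray (F - {{1..n}}))"
proof
  fix w assume "w \<in> trop_pts n (cm_ideal n 2)"
  then obtain N :: nat and x where w0: "\<And>i. i \<notin> pairs n \<Longrightarrow> w i = 0" and N: "N > 0"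
    and x: "\<And>f. f \<in> cm_ideal n 2 \<Longrightarrow> peval fls_const n f x = 0"
    and xi: "\<And>i. i \<in> pairs n \<Longrightarrow> x i \<noteq> 0" "\<And>i. i \<in> pairs n \<Longrightarrow> w i = - of_int (fls_subdegree (x i)) / real N"
    unfolding trop_pts_def by blast
  have "(1, 2) \<in> pairs n"
    using n by (simp add: pairs_def)
  from xi(1)[OF this] obtain a X Y where a: "a \<noteq> 0"
    and XY: "\<And>u v. u \<in> {1..n} \<Longrightarrow> v \<in> {1..n} \<Longrightarrow>
           a * fls_compose_power (sqdist x u v) 2 = (X u - X v) * (Y u - Y v)"
    using isotropic_factorization[OF x n] by blast
  have sq: "sqdist x u v \<noteq> 0" if "u \<in> {1..n}" "v \<in> {1..n}" "u \<noteq> v" for u v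
  proof -
    have "(min u v, max u v) \<in> pairs n"
      using that by (auto simp: pairs_def)
    then show ?thesis using xi(1) that by (simp add: sqdist_def)
  qed
  have ne: "X u \<noteq> X v" "Y u \<noteq> Y v" if uv: "u \<in> {1..n}" "v \<in> {1..n}" "u \<noteq> v" for u v
    using XY[OF uv(1,2)] a fls_subdegree_compose_power[of 2, OF _ sq[OF uv]] by auto
  obtain S l m where S: "rooted_tree_on n S" "\<And>A. 0 \<le> l A" "\<And>u v. u \<in> {1..n} \<Longrightarrow> v \<in> {1..n} \<Longrightarrow> u \<noteq> v \<Longrightarrow>
           real_of_int (fls_subdegree (X u - X v)) = m + clique_sum (clades S - {{1..n}}) l u v"
    using ultrametric_tree[OF subdegree_ultrametric[of n X, OF ne(1)] n] by metis
  obtain T l' m' where T: "rooted_tree_on n T" "\<And>A. 0 \<le> l' A" "\<And>u v. u \<in> {1..n} \<Longrightarrow> v \<in> {1..n} \<Longrightarrow> u \<noteq> v \<Longrightarrow>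
           real_of_int (fls_subdegree (Y u - Y v)) = m' + clique_sum (clades T - {{1..n}}) l' u v"
    using ultrametric_tree[OF subdegree_ultrametric[of n Y, OF ne(2)] n] by metis
  let ?F = "clades S \<union> clades T"
  have F: "?F \<in> TP n"
    unfolding TP_def using S(1) T(1) by blast
  have fin: "finite ?F"
    using TP_props[OF F n] by blast
  have scale: "clique_sum G (\<lambda>A. l A / (2 * real N)) u v = clique_sum G l u v / (2 * real N)" for G l u v
    by (simp add: clique_sum_def sum_divide_distrib)
  have "w \<in> qcone n ray ((clades S - {{1..n}}) \<union> (clades T - {{1..n}}))"
  proof (rule qcone_Un)
    \<comment> \<open>In \<open>2 * real N\<close>, the factor \<open>N\<close> converts to
      exponents of t and 2 undoes the substitution of s^2. The order of \<open>a\<close> and the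
      constants of both ultrametrics merge into the lineality coordinate.\<close>
    show "w i = (if i \<in> pairs n then (fls_subdegree a - m - m') / (2 * real N)
        - clique_sum (clades S - {{1..n}}) (\<lambda>A. l A / (2 * real N)) (fst i) (snd i)
        - clique_sum (clades T - {{1..n}}) (\<lambda>A. l' A / (2 * real N)) (fst i) (snd i) else 0)" for i
    proof (cases "i \<in> pairs n")
      case True
      obtain u v where i: "i = (u, v)" by (cases i)
      then have uv: "u \<in> {1..n}" "v \<in> {1..n}" "u < v"
        using True by (auto simp: pairs_def)
      have xuv: "sqdist x u v = x i"
        using uv(3) by (simp add: sqdist_def i min_def max_def)
      have "fls_subdegree a + 2 * fls_subdegree (x i)
          = fls_subdegree (a * fls_compose_power (sqdist x u v) 2)"
        using fls_subdegree_compose_power[of 2 "x i"] xi(1)[OF True] a by (simp add: xuv)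
      also have "\<dots> = fls_subdegree (X u - X v) + fls_subdegree (Y u - Y v)"
        using XY[OF uv(1,2)] ne[OF uv(1,2)] uv(3) by simp
      finally have "real_of_int (fls_subdegree a) + 2 * real_of_int (fls_subdegree (x i))
          = real_of_int (fls_subdegree (X u - X v)) + real_of_int (fls_subdegree (Y u - Y v))"
        by linarith
      then have "2 * real_of_int (fls_subdegree (x i))
          = m + clique_sum (clades S - {{1..n}}) l u v + m' + clique_sum (clades T - {{1..n}}) l' u v
            - real_of_int (fls_subdegree a)"
        using S(3)[OF uv(1,2)] T(3)[OF uv(1,2)] uv(3) by simp
      then have "w i = (real_of_int (fls_subdegree a) - m - m' - clique_sum (clades S - {{1..n}}) l u v
          - clique_sum (clades T - {{1..n}}) l' u v) / (2 * real N)"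
        unfolding xi(2)[OF True] using N by (simp add: field_simps)
      then show ?thesis
        using True unfolding scale by (simp add: i diff_divide_distrib)
    qed (simp add: w0)
  qed (use fin S(2) T(2) N in auto)
  then have "w \<in> qcone n ray (?F - {{1..n}})"
    by (simp add: Un_Diff)
  then show "w \<in> (\<Union>F\<in>TP n. qcone n ray (F - {{1..n}}))"
    using F by blast
qed

section \<open>Cones lie in the tropical variety\<close>

lemma tendsto_funI:
  fixes f :: "'b \<Rightarrow> 'i \<Rightarrow> 'a::topological_space"
  assumes "\<And>i. ((\<lambda>c. f c i) \<longlongrightarrow> l i) F"
  shows "(f \<longlongrightarrow> l) F"
proof -
  have "limitin (product_topology (\<lambda>i::'i. euclidean :: 'a topology) UNIV) f l F"
    unfolding limitin_componentwise using assms by simp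
  then show ?thesis
    by (simp add: euclidean_product_topology)
qed

text \<open>Serves to approximate several reals at once by fractions with the common denominator
  \<open>Suc k\<close>, which becomes the \<open>N\<close> of the Puiseux series.\<close>

lemma floor_approx_tendsto: "(\<lambda>k. real_of_int \<lfloor>real (Suc k) * c\<rfloor> / real (Suc k)) \<longlonglongrightarrow> c"
proof (rule tendsto_sandwich)
  show "\<forall>\<^sub>F k in sequentially. c - inverse (real (Suc k)) \<le> real_of_int \<lfloor>real (Suc k) * c\<rfloor> / real (Suc k)"
  proof (rule always_eventually, rule allI)
    fix k
    have "real (Suc k) * c - 1 \<le> real_of_int \<lfloor>real (Suc k) * c\<rfloor>" by linarith
    then have "(real (Suc k) * c - 1) / real (Suc k) \<le> real_of_int \<lfloor>real (Suc k) * c\<rfloor> / real (Suc k)"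
      by (rule divide_right_mono) simp
    then show "c - inverse (real (Suc k)) \<le> real_of_int \<lfloor>real (Suc k) * c\<rfloor> / real (Suc k)"
      by (simp add: diff_divide_distrib inverse_eq_divide)
  qed
  show "\<forall>\<^sub>F k in sequentially. real_of_int \<lfloor>real (Suc k) * c\<rfloor> / real (Suc k) \<le> c"
  proof (rule always_eventually, rule allI)
    fix k
    have "real_of_int \<lfloor>real (Suc k) * c\<rfloor> \<le> real (Suc k) * c" by linarith
    then show "real_of_int \<lfloor>real (Suc k) * c\<rfloor> / real (Suc k) \<le> c"
      by (simp add: divide_le_eq mult.commute)
  qed
  show "(\<lambda>k. c - inverse (real (Suc k))) \<longlonglongrightarrow> c"
    using tendsto_diff[OF tendsto_const LIMSEQ_inverse_real_of_nat, of c] by simp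
qed simp

text \<open>Nonnegative integer weights on two laminar families give two ultrametrics, realized as
  orders of differences of series \<open>X\<close> and \<open>Y\<close>; the products of these
  differences are squared distances in isotropic coordinates.\<close>

lemma rational_point_realizable:
  assumes n: "2 \<le> n" and F: "F \<in> TP n" and N: "N > 0"
    and a: "\<And>A. A \<in> F - {{1..n}} \<Longrightarrow> 0 \<le> a A"
  shows "(\<lambda>i. if i \<in> pairs n then (real_of_int m - real_of_int (clique_sum (F - {{1..n}}) a (fst i) (snd i))) / real N
      else 0) \<in> trop_pts n (cm_ideal n 2)"
proof -
  obtain L0 M0 where LM: "F = L0 \<union> M0" "laminar L0" "laminar M0" "finite F"
    using TP_props[OF F n] by metis
  define L where "L = L0 - {{1..n}}"
  \<comment> \<open>A clade of both families is assigned to \<open>L\<close> alone, so that its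
    weight is counted once.\<close>
  define M where "M = M0 - L0 - {{1..n}}"
  have lam: "laminar L" "laminar M" and fin: "finite L" "finite M"
    using LM by (auto simp: L_def M_def intro: laminar_subset)
  have a0: "0 \<le> a A" if "A \<in> L \<or> A \<in> M" for A
    using that a LM(1) by (auto simp: L_def M_def)
  have nonneg: "0 \<le> clique_sum L a u v" "0 \<le> clique_sum M a u v" for u v
    unfolding clique_sum_def using a0 by (auto intro!: sum_nonneg)
  have "ultrametric_on n (clique_sum L a)"
    using laminar_ultrametric[OF lam(1) fin(1)] a0 by blast
  from ultrametric_realizable[OF this nonneg(1)]
  obtain X :: "nat \<Rightarrow> complex fls" where X: "\<And>u v. u \<in> {1..n} \<Longrightarrow> v \<in> {1..n} \<Longrightarrow> u \<noteq> v \<Longrightarrow>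
      X u \<noteq> X v \<and> fls_subdegree (X u - X v) = clique_sum L a u v"
    by metis
  have "ultrametric_on n (clique_sum M a)"
    using laminar_ultrametric[OF lam(2) fin(2)] a0 by blast
  from ultrametric_realizable[OF this nonneg(2)]
  obtain Y :: "nat \<Rightarrow> complex fls" where Y: "\<And>u v. u \<in> {1..n} \<Longrightarrow> v \<in> {1..n} \<Longrightarrow> u \<noteq> v \<Longrightarrow>
      Y u \<noteq> Y v \<and> fls_subdegree (Y u - Y v) = clique_sum M a u v"
    by metis
  \<comment> \<open>Scaling all \<open>X u\<close> by a monomial of degree \<open>- m\<close> shifts
    every order by \<open>- m\<close>, which realizes the constant \<open>m\<close>.\<close>
  define s :: "complex fls" where "s = fls_X_intpow (- m)"
  have "fls_nth s (- m) \<noteq> 0"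
    by (simp add: s_def)
  then have s: "s \<noteq> 0" "fls_subdegree s = - m"
    by (metis fls_zero_nth) (simp add: s_def)
  define x where "x i = (s * X (fst i) - s * X (snd i)) * (Y (fst i) - Y (snd i))" for i
  have "\<forall>f\<in>cm_ideal n 2. peval fls_const n f x = 0"
    unfolding x_def using cm_ideal_vanishes_product[where X = "\<lambda>u. s * X u" and Y = Y] by blast
  moreover have "x i \<noteq> 0 \<and> (real_of_int m - real_of_int (clique_sum (F - {{1..n}}) a (fst i) (snd i))) / real N
      = - of_int (fls_subdegree (x i)) / real N" if i: "i \<in> pairs n" for i
  proof -
    obtain u v where uv: "i = (u, v)" by (cases i)
    then have "u \<in> {1..n}" "v \<in> {1..n}" "u \<noteq> v"
      using i by (auto simp: pairs_def)
    note XY = X[OF this] Y[OF this]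
    have xi: "x i = s * ((X u - X v) * (Y u - Y v))"
      by (simp add: x_def uv algebra_simps)
    then have "x i \<noteq> 0" using s XY by simp
    moreover have "fls_subdegree (x i) = - m + (clique_sum L a u v + clique_sum M a u v)"
      unfolding xi using s XY by simp
    moreover have "clique_sum (F - {{1..n}}) a u v = clique_sum L a u v + clique_sum M a u v"
    proof -
      have eq: "F - {{1..n}} = L \<union> M" and disj: "L \<inter> M = {}"
        using LM(1) by (auto simp: L_def M_def)
      show ?thesis
        unfolding clique_sum_def eq by (rule sum.union_disjoint[OF fin disj])
    qed
    ultimately show ?thesis by (simp add: uv)
  qed
  ultimately show ?thesis
    unfolding trop_pts_def using N by (intro CollectI conjI exI[of _ N] exI[of _ x]) auto
qed

lemma qcone_subset_trop:
  assumes n: "2 \<le> n" and F: "F \<in> TP n"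
  shows "qcone n ray (F - {{1..n}}) \<subseteq> trop n (cm_ideal n 2)"
proof
  let ?F = "F - {{1..n}}"
  fix w assume "w \<in> qcone n ray ?F"
  then obtain lam mu where lam: "\<And>A. A \<in> ?F \<Longrightarrow> 0 \<le> lam A"
    and w: "\<And>i. w i = (if i \<in> pairs n then mu - clique_sum ?F lam (fst i) (snd i) else 0)"
    by (rule qcone_rayE) (rule that)
  \<comment> \<open>Coefficients and constant are rounded down to multiples of 1 /
    \<open>Suc k\<close>; this keeps the coefficients nonnegative.\<close>
  define W where "W k i = (if i \<in> pairs n then (real_of_int \<lfloor>real (Suc k) * mu\<rfloor>
      - real_of_int (clique_sum ?F (\<lambda>A. \<lfloor>real (Suc k) * lam A\<rfloor>) (fst i) (snd i))) / real (Suc k) else 0)" for k i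
  have "W k \<in> trop_pts n (cm_ideal n 2)" for k
    unfolding W_def by (rule rational_point_realizable[OF n F]) (use lam in auto)
  moreover have "W \<longlonglongrightarrow> w"
  proof (rule tendsto_funI)
    fix i
    show "(\<lambda>k. W k i) \<longlonglongrightarrow> w i"
    proof (cases "i \<in> pairs n")
      case True
      have "W k i = real_of_int \<lfloor>real (Suc k) * mu\<rfloor> / real (Suc k)
          - (\<Sum>A\<in>?F. real_of_int \<lfloor>real (Suc k) * lam A\<rfloor> / real (Suc k) * of_bool (fst i \<in> A \<and> snd i \<in> A))" for k
        using True by (simp add: W_def clique_sum_def diff_divide_distrib sum_divide_distrib del: of_nat_Suc)
      moreover have "w i = mu - (\<Sum>A\<in>?F. lam A * of_bool (fst i \<in> A \<and> snd i \<in> A))"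
        using True by (simp add: w clique_sum_def)
      ultimately show ?thesis
        by (simp only:) (intro tendsto_intros floor_approx_tendsto)
    qed (simp add: W_def w)
  qed
  ultimately show "w \<in> trop n (cm_ideal n 2)"
    unfolding trop_def
    by (intro Lim_in_closed_set[OF closed_closure _ sequentially_bot, of W])
      (auto intro: always_eventually subsetD[OF closure_subset])
qed

section \<open>Closedness of the cones\<close>

lemma compact_cube: "compact {f :: 'i \<Rightarrow> real. \<forall>i. f i \<in> {a..b}}"
proof -
  have "compactin (product_topology (\<lambda>i::'i. euclidean :: real topology) UNIV) (PiE UNIV (\<lambda>i. {a..b}))"
    unfolding compactin_PiE by simp
  moreover have "PiE UNIV (\<lambda>i::'i. {a..b}) = {f. \<forall>i. f i \<in> {a..b}}"
    by (auto simp: PiE_iff)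
  ultimately show ?thesis
    by (simp add: euclidean_product_topology)
qed

text \<open>Some edge lies in no proper clade, so the lineality coordinate of a point of the cone is its
  largest entry; hence bounded points have bounded coefficients.\<close>

lemma closed_qcone:
  assumes n: "2 \<le> n" and F: "F \<in> TP n"
  shows "closed (qcone n ray (F - {{1..n}}))"
proof -
  let ?F = "F - {{1..n}}"
  obtain L M where LM: "F = L \<union> M" "laminar L" "laminar M" "finite L" "finite M"
    and sub: "\<And>A. A \<in> F \<Longrightarrow> A \<subseteq> {1..n}" and card: "\<And>A. A \<in> F \<Longrightarrow> 2 \<le> card A" and fin: "finite F"
    using TP_props[OF F n] by metis
  \<comment> \<open>If the proper clades of the two trees covered all pairs, one of them would
    contain \<open>{1..n}\<close>.\<close>
  have "\<exists>u\<in>{1..n}. \<exists>v\<in>{1..n}. u \<noteq> v \<and> (\<forall>A\<in>?F. \<not> (u \<in> A \<and> v \<in> A))"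
  proof (rule ccontr)
    assume neg: "\<not> ?thesis"
    have "\<exists>B\<in>(L - {{1..n}}) \<union> (M - {{1..n}}). {1..n} \<subseteq> B"
    proof (rule clique_cover_by_two_laminar)
      show "\<exists>u\<in>{1..n}. \<exists>v\<in>{1..n}. u \<noteq> v"
        using n by (intro bexI[of _ 1] bexI[of _ 2]) auto
      show "\<exists>B\<in>(L - {{1..n}}) \<union> (M - {{1..n}}). u \<in> B \<and> v \<in> B"
        if "u \<in> {1..n}" "v \<in> {1..n}" "u \<noteq> v" for u v
        using neg that LM(1) by blast
    qed (use LM in \<open>auto intro: laminar_subset\<close>)
    then show False using sub LM(1) by blast
  qed
  then obtain a b where ab: "a \<in> {1..n}" "b \<in> {1..n}" "a \<noteq> b" "\<And>A. A \<in> ?F \<Longrightarrow> \<not> (a \<in> A \<and> b \<in> A)"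
    by blast
  \<comment> \<open>No proper clade contributes at this edge, so \<open>w i0\<close> is the constant
    \<open>mu\<close>.\<close>
  define i0 where "i0 = (min a b, max a b)"
  have i0: "i0 \<in> pairs n"
    using ab(1-3) by (auto simp: i0_def pairs_def)
  have i0_zero: "clique_sum ?F lam (fst i0) (snd i0) = (0::real)" for lam
    unfolding clique_sum_def using ab(4) by (intro sum.neutral) (auto simp: i0_def min_def max_def)
  define \<Phi> where "\<Phi> q i = (if i \<in> pairs n then snd q - clique_sum ?F (fst q) (fst i) (snd i) else 0)"
    for q :: "(nat set \<Rightarrow> real) \<times> real" and i
  define box where "box R = {f :: nat set \<Rightarrow> real. \<forall>A. f A \<in> {0..2 * R}} \<times> {- R..R}" for R
  have cont: "continuous_on UNIV \<Phi>"
  proof (rule continuous_on_coordinatewise_then_product)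
    fix i
    have proj: "continuous_on UNIV (\<lambda>q :: (nat set \<Rightarrow> real) \<times> real. fst q A)" for A
    proof -
      have "continuous_on UNIV ((\<lambda>f :: nat set \<Rightarrow> real. f A) \<circ> (fst :: (nat set \<Rightarrow> real) \<times> real \<Rightarrow> _))"
        by (intro continuous_on_compose continuous_on_fst continuous_on_id
            continuous_on_subset[OF continuous_on_product_coordinates]) auto
      then show ?thesis by (simp add: comp_def)
    qed
    show "continuous_on UNIV (\<lambda>q. \<Phi> q i)"
      unfolding \<Phi>_def clique_sum_def
      by (cases "i \<in> pairs n") (auto intro!: continuous_intros proj)
  qed
  have cpt: "compact (\<Phi> ` box R)" for R
    unfolding box_def
    by (intro compact_continuous_image continuous_on_subset[OF cont] compact_Times compact_cube) auto
  have img: "\<Phi> ` box R \<subseteq> qcone n ray ?F" for R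
  proof
    fix w assume "w \<in> \<Phi> ` box R"
    then obtain q where q: "q \<in> box R" "w = \<Phi> q" by blast
    then have "0 \<le> fst q A" for A
      by (cases q) (simp add: box_def)
    then show "w \<in> qcone n ray ?F"
      unfolding q(2) by (intro qcone_rayI[of _ "fst q" _ _ "snd q"]) (simp_all add: \<Phi>_def)
  qed
  \<comment> \<open>\<open>lam A\<close> is at most the clique sum at an edge inside
    \<open>A\<close>, which is \<open>mu - w (u, v)\<close>; both terms are below \<open>R\<close>
    in absolute value.\<close>
  have bounded: "w \<in> \<Phi> ` box R" if w: "w \<in> qcone n ray ?F" and R: "\<And>i. i \<in> pairs n \<Longrightarrow> \<bar>w i\<bar> < R" for w R
  proof -
    obtain lam mu where lam: "\<And>A. A \<in> ?F \<Longrightarrow> 0 \<le> lam A"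
      and wi: "\<And>i. w i = (if i \<in> pairs n then mu - clique_sum ?F lam (fst i) (snd i) else 0)"
      using w by (rule qcone_rayE) (rule that)
    define l where "l A = (if A \<in> ?F then lam A else 0)" for A
    have mu: "\<bar>mu\<bar> < R"
      using R[OF i0] i0 unfolding wi i0_zero by simp
    have l_le: "l A \<le> 2 * R" for A
    proof (cases "A \<in> ?F")
      case True
      have "\<not> card A \<le> Suc 0" "finite A"
        using card[of A] sub[of A] True finite_subset by auto
      then obtain u v where uv: "u \<in> A" "v \<in> A" "u < v"
        using card_le_Suc0_iff_eq by (metis linorder_neqE_nat)
      then have i: "(u, v) \<in> pairs n"
        using sub[of A] True by (auto simp: pairs_def)
      have "lam A = lam A * of_bool (u \<in> A \<and> v \<in> A)" using uv by simp
      also have "\<dots> \<le> clique_sum ?F lam u v"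
        unfolding clique_sum_def using lam fin True by (intro member_le_sum) auto
      also have "\<dots> = mu - w (u, v)" using i by (simp add: wi)
      also have "\<dots> \<le> 2 * R" using R[OF i] mu by simp
      finally show ?thesis using True by (simp add: l_def)
    next
      case False
      then have "l A = 0"
        unfolding l_def by (rule if_not_P)
      then show ?thesis using mu by simp
    qed
    have "(l, mu) \<in> box R"
      using l_le lam mu by (auto simp: box_def l_def)
    moreover have "clique_sum ?F l u v = clique_sum ?F lam u v" for u v
      unfolding clique_sum_def by (intro sum.cong) (auto simp: l_def)
    then have "w = \<Phi> (l, mu)"
      by (simp add: fun_eq_iff \<Phi>_def wi)
    ultimately show ?thesis by blast
  qed
  have "w \<in> qcone n ray ?F" if w: "w \<in> closure (qcone n ray ?F)" for w
  proof -
    \<comment> \<open>\<open>U\<close> is an open neighbourhood of \<open>w\<close> with entries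
      bounded by \<open>R\<close>. Inside it the cone lies in the compact image of a box, which
      therefore contains \<open>w\<close>.\<close>
    define R where "R = (\<Sum>i\<in>pairs n. \<bar>w i\<bar>) + 1"
    define U where "U = (\<Inter>i\<in>pairs n. {w' :: nat \<times> nat \<Rightarrow> real. \<bar>w' i\<bar> < R})"
    have "open U"
      unfolding U_def
    proof (intro open_INT finite_pairs ballI)
      fix i show "open {w' :: nat \<times> nat \<Rightarrow> real. \<bar>w' i\<bar> < R}"
        by (intro open_Collect_less continuous_intros continuous_on_product_coordinates)
    qed
    moreover have "w \<in> U"
      unfolding U_def R_def
      using member_le_sum[of _ "pairs n" "\<lambda>i. \<bar>w i\<bar>"] finite_pairs by fastforce
    ultimately have "w \<in> closure (U \<inter> qcone n ray ?F)"
      using w open_Int_closure_subset by blast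
    also have "\<dots> \<subseteq> closure (\<Phi> ` box R)"
      by (intro closure_mono) (auto simp: U_def intro: bounded)
    also have "\<dots> = \<Phi> ` box R"
      using cpt compact_imp_closed by (intro closure_closed) blast
    finally show ?thesis using img by blast
  qed
  then show ?thesis
    by (metis closure_subset_eq subsetI)
qed

lemma finite_TP:
  assumes "2 \<le> n"
  shows "finite (TP n)"
proof (rule finite_subset)
  show "TP n \<subseteq> Pow (Pow {1..n})"
    using TP_props[OF _ assms] by (metis PowI subsetI)
qed simp

theorem theorem3p4:
  fixes n :: nat
  assumes "n \<ge> 2"
  shows "simplicial_fan_iso_TP n (trop n (cm_ideal n 2))"
  unfolding simplicial_fan_iso_TP_def
proof (intro exI[of _ ray] conjI ballI)
  \<comment> \<open>\<open>TP n\<close> is finite, so the union of the closed cones is closed and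
    the inclusion passes from \<open>trop_pts\<close> to its closure.\<close>
  have "closed (\<Union>F\<in>TP n. qcone n ray (F - {{1..n}}))"
    using finite_TP closed_qcone assms by (intro closed_UN) auto
  then have "trop n (cm_ideal n 2) \<subseteq> (\<Union>F\<in>TP n. qcone n ray (F - {{1..n}}))"
    unfolding trop_def using trop_pts_subset[OF assms] by (rule closure_minimal[rotated])
  then show "(\<Union>F\<in>TP n. qcone n ray (F - {{1..n}})) = trop n (cm_ideal n 2)"
    using qcone_subset_trop[OF assms] by blast
next
  fix F assume "F \<in> TP n"
  then show "indep_mod_ones n ray (F - {{1..n}})"
    using assms by (rule indep_ray)
next
  fix F G assume "F \<in> TP n" "G \<in> TP n"
  then show "qcone n ray (F - {{1..n}}) \<inter> qcone n ray (G - {{1..n}}) = qcone n ray ((F \<inter> G) - {{1..n}})"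
    by (rule qcone_Int[OF assms])
qed

end
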